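(* Let $G$ be a finite connected graph. Breaker has a winning strategy in the $P_4$-game on $G$ if and only if at least one of the following holds: (1) $G$ is bipartite and there is a bipartition of $V(G)$ into two parts such that all vertices of degree at least $3$ lie in the same part; (2) $G$ is a cycle of odd length; (3) $G$ is isomorphic to a subgraph of the bull, of $K_4$, or of the graph obtained from a $5$-cycle $C_5$ by attaching one pendant vertex (a leaf) to one of its vertices.
   Context: In a Maker-Breaker game on the edge set of a graph $G$, Maker and Breaker alternately claim previously unclaimed edges of $G$, Maker first, until all edges are claimed; Maker wins if she claims all edges of some winning set, and Breaker wins otherwise. In the $P_4$-game, the winning sets are the edge sets of subgraphs of $G$ isomorphic to $P_4$, the path with $4$ vertices and $3$ edges. The bull is the graph obtained from a triangle by attaching one pendant vertex to each of two distinct vertices of the triangle (5 vertices, 5 edges). *)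

theory Defs
  imports Main
begin

record 'a ugraph =
  uverts :: "'a set"
  uedges :: "'a set set"

definition finite_simple_graph :: "'a ugraph \<Rightarrow> bool" where
  "finite_simple_graph G \<longleftrightarrow>
     finite (uverts G) \<and> (\<forall>e\<in>uedges G. e \<subseteq> uverts G \<and> card e = 2)"

text \<open>A connected graph has at least one vertex. The edges of a simple graph lie inside
  its vertex set, so walks need not be restricted to it.\<close>

definition connected_ugraph :: "'a ugraph \<Rightarrow> bool" where
  "connected_ugraph G \<longleftrightarrow>
     uverts G \<noteq> {} \<and>
     (\<forall>u\<in>uverts G. \<forall>v\<in>uverts G. (u, v) \<in> {(x, y). {x, y} \<in> uedges G}\<^sup>*)"

definition udegree :: "'a ugraph \<Rightarrow> 'a \<Rightarrow> nat" where
  "udegree G v = card {e \<in> uedges G. v \<in> e}"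

text \<open>The parts may be empty, so that the one-vertex graph is bipartite.\<close>

definition is_bipartition :: "'a ugraph \<Rightarrow> 'a set \<Rightarrow> 'a set \<Rightarrow> bool" where
  "is_bipartition G A B \<longleftrightarrow>
     A \<union> B = uverts G \<and> A \<inter> B = {} \<and>
     (\<forall>e\<in>uedges G. \<exists>a\<in>A. \<exists>b\<in>B. e = {a, b})"

definition is_subgraph :: "'a ugraph \<Rightarrow> 'a ugraph \<Rightarrow> bool" where
  "is_subgraph H G \<longleftrightarrow>
     finite_simple_graph H \<and> uverts H \<subseteq> uverts G \<and> uedges H \<subseteq> uedges G"

definition isomorphic_ugraph :: "'a ugraph \<Rightarrow> 'b ugraph \<Rightarrow> bool" where
  "isomorphic_ugraph G H \<longleftrightarrow>
     (\<exists>f. bij_betw f (uverts G) (uverts H) \<and>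
          (\<forall>u\<in>uverts G. \<forall>v\<in>uverts G. {u, v} \<in> uedges G \<longleftrightarrow> {f u, f v} \<in> uedges H))"

definition isomorphic_to_subgraph_of :: "'a ugraph \<Rightarrow> 'b ugraph \<Rightarrow> bool" where
  "isomorphic_to_subgraph_of G H \<longleftrightarrow> (\<exists>H'. is_subgraph H' H \<and> isomorphic_ugraph G H')"

definition path_ugraph :: "nat \<Rightarrow> nat ugraph" where
  "path_ugraph n = \<lparr>uverts = {..<n}, uedges = {{i, Suc i} | i. Suc i < n}\<rparr>"

text \<open>Only a cycle for \<open>n \<ge> 3\<close>.\<close>

definition cycle_ugraph :: "nat \<Rightarrow> nat ugraph" where
  "cycle_ugraph n = \<lparr>uverts = {..<n}, uedges = {{i, Suc i mod n} | i. i < n}\<rparr>"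

definition complete_ugraph :: "nat \<Rightarrow> nat ugraph" where
  "complete_ugraph n = \<lparr>uverts = {..<n}, uedges = {{i, j} | i j. i < n \<and> j < n \<and> i \<noteq> j}\<rparr>"

text \<open>The vertex \<open>w\<close> must not already be a vertex of \<open>G\<close>.\<close>

definition attach_leaf :: "'a \<Rightarrow> 'a \<Rightarrow> 'a ugraph \<Rightarrow> 'a ugraph" where
  "attach_leaf v w G = \<lparr>uverts = insert w (uverts G), uedges = insert {v, w} (uedges G)\<rparr>"

definition bull_ugraph :: "nat ugraph" where
  "bull_ugraph = attach_leaf 1 4 (attach_leaf 0 3 (cycle_ugraph 3))"

definition C5_with_leaf :: "nat ugraph" where
  "C5_with_leaf = attach_leaf 0 5 (cycle_ugraph 5)"


text \<open>A game is given by a finite board \<open>X\<close> and a family \<open>W\<close> of winning sets. A play is the list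
  of all claimed elements in the order in which they are claimed; Maker moves first, so she
  claims the entries at the even positions (counted from 0) and Breaker those at the odd ones.\<close>

definition complete_play :: "'e set \<Rightarrow> 'e list \<Rightarrow> bool" where
  "complete_play X p \<longleftrightarrow> distinct p \<and> set p = X"

definition maker_claims :: "'e list \<Rightarrow> 'e set" where
  "maker_claims p = {p ! i | i. i < length p \<and> even i}"

definition maker_wins_play :: "'e set set \<Rightarrow> 'e list \<Rightarrow> bool" where
  "maker_wins_play W p \<longleftrightarrow> (\<exists>S\<in>W. S \<subseteq> maker_claims p)"

text \<open>A strategy maps the history of the play so far to the next move. For Breaker it must
  answer every history in which it is his turn with an unclaimed element; without this
  requirement a strategy making illegal moves would win vacuously.\<close>

definition breaker_strategy :: "'e set \<Rightarrow> ('e list \<Rightarrow> 'e) \<Rightarrow> bool" where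
  "breaker_strategy X \<sigma> \<longleftrightarrow>
     (\<forall>h. distinct h \<and> set h \<subset> X \<and> odd (length h) \<longrightarrow> \<sigma> h \<in> X - set h)"

definition follows_breaker_strategy :: "('e list \<Rightarrow> 'e) \<Rightarrow> 'e list \<Rightarrow> bool" where
  "follows_breaker_strategy \<sigma> p \<longleftrightarrow>
     (\<forall>i<length p. odd i \<longrightarrow> p ! i = \<sigma> (take i p))"

definition breaker_has_winning_strategy :: "'e set \<Rightarrow> 'e set set \<Rightarrow> bool" where
  "breaker_has_winning_strategy X W \<longleftrightarrow>
     (\<exists>\<sigma>. breaker_strategy X \<sigma> \<and>
          (\<forall>p. complete_play X p \<and> follows_breaker_strategy \<sigma> p \<longrightarrow> \<not> maker_wins_play W p))"

definition P4_winning_sets :: "'a ugraph \<Rightarrow> 'a set set set" where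
  "P4_winning_sets G = {uedges H | H. is_subgraph H G \<and> isomorphic_ugraph H (path_ugraph 4)}"

definition breaker_wins_P4_game :: "'a ugraph \<Rightarrow> bool" where
  "breaker_wins_P4_game G \<longleftrightarrow> breaker_has_winning_strategy (uedges G) (P4_winning_sets G)"

end

(* The game is finite, so Breaker wins iff Maker cannot force a win, and it suffices to exhibit
   pairings for Breaker and double threats for Maker. If all vertices of degree at least 3 lie on
   one side, Breaker pairs the two edges at every vertex of degree 2 on the other side: one inner
   vertex of each P4 is there. Conversely, two vertices of degree at least 3 joined by a path of
   odd length give Maker a win: she claims every second edge of the path, each time forcing the
   reply, and arrives at the far end with a double threat. If G is not bipartite, a shortest odd
   closed walk is an induced cycle. When it has length at least 7, Maker opens opposite to a
   vertex with a neighbour off the cycle and then runs towards that vertex in whichever direction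
   Breaker left open; lengths 5 and 3 leave a few small extensions, on which Maker wins directly. *)

theory Submission
  imports Defs
begin

section \<open>Forced wins and pairing strategies\<close>

text \<open>Forcing advances two edges at a time, so a run from Maker's first edge to the vertex of
  the final double threat must have even length. On an odd cycle with n edges, the two runs from an
  opening edge to a fixed vertex overlap in that edge alone, so their lengths add up to n + 1 and
  both can be even at once, whichever way Breaker blocks. For n at least 7 both can have length at
  least 4. In a pentagon one of them would have length 2, and the reply that blocks it also takes
  one of the two edges meant for the final threat: this is why a pentagon with one leaf escapes. On
  Breaker's side, an odd cycle has no independent set of vertices that meets every edge, so a
  pairing at vertices alone cannot suffice; his first reply has to destroy the paths that the
  pairing misses.\<close>

text \<open>\<open>mwin X W M B\<close>: Maker, who is to move and has claimed \<open>M\<close> against Breaker's \<open>B\<close>, can force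
  a win. The rule \<open>final\<close> is needed because \<open>step\<close> requires that Breaker has a reply.\<close>

inductive mwin :: "'e set \<Rightarrow> 'e set set \<Rightarrow> 'e set \<Rightarrow> 'e set \<Rightarrow> bool"
  for X :: "'e set" and W :: "'e set set" where
  won: "S \<in> W \<Longrightarrow> S \<subseteq> M \<Longrightarrow> mwin X W M B"
| final: "e \<in> X - (M \<union> B) \<Longrightarrow> S \<in> W \<Longrightarrow> S \<subseteq> insert e M \<Longrightarrow> mwin X W M B"
| step: "e \<in> X - (M \<union> B) \<Longrightarrow> X - (insert e M \<union> B) \<noteq> {} \<Longrightarrow>
    (\<And>b. b \<in> X - (insert e M \<union> B) \<Longrightarrow> mwin X W (insert e M) (insert b B)) \<Longrightarrow> mwin X W M B"

lemma maker_claims_Nil [simp]: "maker_claims [] = {}"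
  by (simp add: maker_claims_def)

lemma maker_claims_snoc:
  "maker_claims (h @ [x]) = (if even (length h) then insert x (maker_claims h) else maker_claims h)"
proof -
  have image: "maker_claims p = (!) p ` {i. i < length p \<and> even i}" for p :: "'a list"
    by (auto simp: maker_claims_def)
  have "{i. i < length (h @ [x]) \<and> even i} =
      (if even (length h) then {length h} else {}) \<union> {i. i < length h \<and> even i}"
    by (auto simp: less_Suc_eq)
  moreover have "(!) (h @ [x]) ` {i. i < length h \<and> even i} = (!) h ` {i. i < length h \<and> even i}"
    by (rule image_cong) (auto simp: nth_append)
  ultimately show ?thesis unfolding image by (simp add: image_Un)
qed

lemma maker_claims_subset: "maker_claims p \<subseteq> set p"
  by (auto simp: maker_claims_def)

lemma follows_snoc:
  "follows_breaker_strategy \<sigma> (h @ [x]) \<longleftrightarrow>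
     follows_breaker_strategy \<sigma> h \<and> (odd (length h) \<longrightarrow> x = \<sigma> h)"
  by (auto simp: follows_breaker_strategy_def nth_append less_Suc_eq)

text \<open>A play is judged only when the whole board is claimed, so a history in which Maker
  already owns a winning set still has to be finished: Breaker continues by \<open>\<sigma>\<close>,
  Maker with any free element, and her claims only grow.\<close>

lemma extend_to_complete_play:
  assumes "breaker_strategy X \<sigma>" "finite X"
    and "distinct h" "set h \<subseteq> X" "follows_breaker_strategy \<sigma> h"
  shows "\<exists>p. complete_play X p \<and> follows_breaker_strategy \<sigma> p \<and> maker_claims h \<subseteq> maker_claims p"
  using assms(3-)
proof (induction "card (X - set h)" arbitrary: h rule: less_induct)
  case less
  show ?case
  proof (cases "set h = X")
    case True
    then show ?thesis using less by (auto simp: complete_play_def)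
  next
    case False
    then obtain y where y: "y \<in> X - set h" using less by auto
    define x where "x = (if odd (length h) then \<sigma> h else y)"
    have x: "x \<in> X - set h"
      using y assms(1) less.prems False unfolding x_def breaker_strategy_def by auto
    have "card (X - set (h @ [x])) < card (X - set h)"
      by (rule psubset_card_mono) (use x assms(2) in auto)
    moreover have "follows_breaker_strategy \<sigma> (h @ [x])"
      using less.prems by (simp add: follows_snoc x_def)
    ultimately have "\<exists>p. complete_play X p \<and> follows_breaker_strategy \<sigma> p \<and>
        maker_claims (h @ [x]) \<subseteq> maker_claims p"
      using less.hyps[of "h @ [x]"] less.prems x by auto
    then show ?thesis by (auto simp: maker_claims_snoc split: if_splits)
  qed
qed

text \<open>Maker walks down the derivation of \<open>mwin\<close>; since \<open>step\<close>
  provides for every reply, it provides for the one that \<open>\<sigma>\<close> actually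
  makes.\<close>

lemma mwin_beats_strategy:
  assumes "mwin X W M B" "breaker_strategy X \<sigma>" "finite X"
    and "distinct h" "set h \<subseteq> X" "even (length h)" "follows_breaker_strategy \<sigma> h"
    and "maker_claims h = M" "set h = M \<union> B"
  shows "\<exists>p. complete_play X p \<and> follows_breaker_strategy \<sigma> p \<and> maker_wins_play W p"
  using assms(1,4-)
proof (induction arbitrary: h rule: mwin.induct)
  case (won S M B)
  then show ?case
    using extend_to_complete_play[OF assms(2,3), of h] unfolding maker_wins_play_def by blast
next
  case (final e M B S)
  then have "distinct (h @ [e])" "set (h @ [e]) \<subseteq> X" "follows_breaker_strategy \<sigma> (h @ [e])"
    "maker_claims (h @ [e]) = insert e M"
    by (auto simp: follows_snoc maker_claims_snoc)
  with extend_to_complete_play[OF assms(2,3), of "h @ [e]"] obtain p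
    where "complete_play X p" "follows_breaker_strategy \<sigma> p" "insert e M \<subseteq> maker_claims p"
    by metis
  then show ?case using final.hyps(2,3) unfolding maker_wins_play_def by (meson subset_trans)
next
  case (step e M B)
  let ?h = "h @ [e]"
  have h: "distinct ?h" "set ?h \<subseteq> X" "follows_breaker_strategy \<sigma> ?h" "odd (length ?h)"
    "maker_claims ?h = insert e M" "set ?h = insert e M \<union> B"
    using step by (auto simp: follows_snoc maker_claims_snoc)
  have "set ?h \<subset> X" using h step(2) by blast
  then have b: "\<sigma> ?h \<in> X - set ?h"
    using assms(2) h unfolding breaker_strategy_def by blast
  show ?case
  proof (rule step.IH)
    show "\<sigma> ?h \<in> X - (insert e M \<union> B)" using b h(6) by blast
    show "distinct (?h @ [\<sigma> ?h])" using b h(1) unfolding distinct_append by simp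
    show "set (?h @ [\<sigma> ?h]) \<subseteq> X" using b h(2) unfolding set_append by simp
    show "even (length (?h @ [\<sigma> ?h]))" using h(4) by simp
    show "follows_breaker_strategy \<sigma> (?h @ [\<sigma> ?h])"
      unfolding follows_snoc[of \<sigma> ?h] using h(3) by blast
    show "maker_claims (?h @ [\<sigma> ?h]) = insert e M"
      unfolding maker_claims_snoc[of ?h] using h(4,5) by argo
    show "set (?h @ [\<sigma> ?h]) = insert e M \<union> insert (\<sigma> ?h) B"
      using h(6) unfolding set_append[of ?h] by simp
  qed
qed

text \<open>Breaker maintains that Maker, when on move, has no forced win. If every reply lost this,
  \<open>step\<close> would have given Maker a forced win one round earlier.\<close>

lemma not_mwin_breaker_strategy:
  assumes "\<not> mwin X W {} {}"
  shows "breaker_has_winning_strategy X W"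
proof -
  define free where "free h b \<longleftrightarrow> b \<in> X - set h" for h b
  define good where "good h b \<longleftrightarrow>
    free h b \<and> \<not> mwin X W (maker_claims h) (insert b (set h - maker_claims h))" for h b
  \<comment> \<open>The second default is for histories that never arise under
    \<open>\<sigma>\<close>: a strategy must answer these legally as well.\<close>
  define \<sigma> where "\<sigma> h = (if \<exists>b. good h b then SOME b. good h b else SOME b. free h b)" for h
  have good: "good h (\<sigma> h)" if "\<exists>b. good h b" for h
    unfolding \<sigma>_def using that by (auto intro: someI2_ex)
  have "\<sigma> h \<in> X - set h" if "set h \<subset> X" for h
  proof (cases "\<exists>b. good h b")
    case True
    then show ?thesis using good[OF True] by (simp add: good_def free_def)
  next
    case False
    have "\<exists>b. free h b" using that by (auto simp: free_def)
    then have "free h (SOME b. free h b)" by (rule someI_ex)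
    then have "free h (\<sigma> h)" using False by (simp add: \<sigma>_def)
    then show ?thesis by (simp add: free_def)
  qed
  then have "breaker_strategy X \<sigma>" by (simp add: breaker_strategy_def)
  moreover have "\<not> maker_wins_play W p"
    if p: "complete_play X p" "follows_breaker_strategy \<sigma> p" for p
  proof -
    let ?M = "\<lambda>k. maker_claims (take k p)"
    have dp: "distinct p" "set p = X" using p by (auto simp: complete_play_def)
    have inv: "\<not> mwin X W (?M (2 * k)) (set (take (2 * k) p) - ?M (2 * k))" if "2 * k \<le> length p" for k
      using that
    proof (induction k)
      case 0
      then show ?case using assms by simp
    next
      case (Suc k)
      let ?k = "2 * k"
      define e b where "e = p ! ?k" and "b = p ! Suc ?k"
      have t1: "take (Suc ?k) p = take ?k p @ [e]"
        using Suc.prems by (simp add: e_def take_Suc_conv_app_nth)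
      have t2: "take (2 * Suc k) p = take (Suc ?k) p @ [b]"
        using Suc.prems by (simp add: b_def take_Suc_conv_app_nth)
      have "distinct (take (2 * Suc k) p)" "set (take (2 * Suc k) p) \<subseteq> X"
        using dp by (auto dest: in_set_takeD)
      then have d: "distinct (take ?k p @ [e] @ [b])" "set (take ?k p @ [e] @ [b]) \<subseteq> X"
        unfolding t1 t2 by auto
      have len: "length (take ?k p) = ?k" using Suc.prems by simp
      have len1: "length (take (Suc ?k) p) = Suc ?k" using Suc.prems by simp
      have M1: "?M (Suc ?k) = insert e (?M ?k)"
        unfolding t1 maker_claims_snoc len by simp
      have M2: "?M (2 * Suc k) = insert e (?M ?k)"
        unfolding t2 maker_claims_snoc len1 M1 by simp
      let ?B = "set (take ?k p) - ?M ?k"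
      have eX: "e \<in> X - (?M ?k \<union> ?B)" using d maker_claims_subset[of "take ?k p"] by auto
      have bX: "b \<in> X - (insert e (?M ?k) \<union> ?B)"
        using d maker_claims_subset[of "take ?k p"] by auto
      have B1: "set (take (Suc ?k) p) - insert e (?M ?k) = ?B"
        using d by (auto simp: t1)
      obtain b' where b': "b' \<in> X - (insert e (?M ?k) \<union> ?B)"
        "\<not> mwin X W (insert e (?M ?k)) (insert b' ?B)"
        using mwin.step[OF eX] bX Suc by auto
      have "b' \<notin> set (take (Suc ?k) p)"
        unfolding t1 using b'(1) by auto
      then have "good (take (Suc ?k) p) b'"
        unfolding good_def free_def B1 M1 using b' by auto
      then have "good (take (Suc ?k) p) (\<sigma> (take (Suc ?k) p))" using good by blast
      moreover have "\<sigma> (take (Suc ?k) p) = b"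
        using p(2) Suc.prems unfolding follows_breaker_strategy_def b_def by simp
      ultimately have "\<not> mwin X W (insert e (?M ?k)) (insert b ?B)"
        unfolding good_def B1 M1 by simp
      moreover have "set (take (2 * Suc k) p) - ?M (2 * Suc k) = insert b ?B"
        unfolding M2 unfolding t2 t1 using d maker_claims_subset[of "take ?k p"] by auto
      ultimately show ?case unfolding M2 by simp
    qed
    show ?thesis
    proof (cases "even (length p)")
      case True
      then obtain k where "length p = 2 * k" by (auto elim: evenE)
      then have "\<not> mwin X W (maker_claims p) (set p - maker_claims p)" using inv[of k] by simp
      then show ?thesis unfolding maker_wins_play_def by (metis mwin.won)
    next
      case False
      then obtain k where k: "length p = Suc (2 * k)" by (auto elim: oddE)
      \<comment> \<open>An odd board ends with a move of Maker that Breaker cannot answer, so the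
        invariant stops one move early and \<open>mwin.final\<close> has to close the gap.\<close>
      define e where "e = p ! (2 * k)"
      have t: "take (2 * k) p @ [e] = p"
        using k take_Suc_conv_app_nth[of "2 * k" p] by (simp add: e_def)
      have M: "maker_claims p = insert e (?M (2 * k))"
        using maker_claims_snoc[of "take (2 * k) p" e] k unfolding t by simp
      have "distinct (take (2 * k) p @ [e])" using dp(1) t by simp
      moreover have "e \<in> X" using dp(2) k by (auto simp: e_def)
      ultimately have "e \<in> X - (?M (2 * k) \<union> (set (take (2 * k) p) - ?M (2 * k)))"
        using maker_claims_subset[of "take (2 * k) p"] by auto
      moreover have "\<not> mwin X W (?M (2 * k)) (set (take (2 * k) p) - ?M (2 * k))"
        using inv[of k] k by simp
      ultimately show ?thesis unfolding maker_wins_play_def M by (metis mwin.final)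
    qed
  qed
  ultimately show ?thesis unfolding breaker_has_winning_strategy_def by blast
qed

lemma breaker_has_winning_strategy_iff:
  assumes "finite X"
  shows "breaker_has_winning_strategy X W \<longleftrightarrow> \<not> mwin X W {} {}"
proof
  assume "breaker_has_winning_strategy X W"
  then obtain \<sigma> where \<sigma>: "breaker_strategy X \<sigma>"
    "\<And>p. complete_play X p \<Longrightarrow> follows_breaker_strategy \<sigma> p \<Longrightarrow> \<not> maker_wins_play W p"
    unfolding breaker_has_winning_strategy_def by blast
  show "\<not> mwin X W {} {}"
  proof
    assume "mwin X W {} {}"
    from mwin_beats_strategy[OF this \<sigma>(1) assms, of "[]"] show False
      using \<sigma>(2) by (auto simp: follows_breaker_strategy_def)
  qed
qed (rule not_mwin_breaker_strategy)

text \<open>Invariant: a member of \<open>Q\<close> that Maker has touched is touched by Breaker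
  too. Winning sets already hit by \<open>B\<close> need no pair, so the lemma can also be applied
  after a first exchange of moves.\<close>

lemma mwin_pairing_False:
  assumes "mwin X W M B"
    and Q: "\<And>q. q \<in> Q \<Longrightarrow> q \<subseteq> X \<and> (\<exists>x\<in>q. \<exists>y\<in>q. x \<noteq> y)"
      "\<And>q r. q \<in> Q \<Longrightarrow> r \<in> Q \<Longrightarrow> q \<inter> r \<noteq> {} \<Longrightarrow> q = r"
    and W: "\<And>S. S \<in> W \<Longrightarrow> S \<inter> B \<noteq> {} \<or> (\<exists>q\<in>Q. q \<subseteq> S)"
    and MB: "M \<inter> B = {}" "\<And>q. q \<in> Q \<Longrightarrow> q \<inter> B \<noteq> {} \<or> q \<inter> M = {}"
  shows False
  using assms(1) W MB
proof induction
  case (won S M B)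
  then show ?case using Q(1) by fastforce
next
  case (final e M B S)
  from final.prems(1)[OF final.hyps(2)] show ?case
  proof
    assume "S \<inter> B \<noteq> {}"
    then show False using final by blast
  next
    assume "\<exists>q\<in>Q. q \<subseteq> S"
    then obtain q where q: "q \<in> Q" "q \<subseteq> insert e M" using final.hyps(3) by blast
    then have "q \<inter> B = {}" using final.hyps(1) final.prems(2) by blast
    then have "q \<inter> M = {}" using final.prems(3)[OF q(1)] by blast
    then show False using q Q(1)[of q] by blast
  qed
next
  case (step e M B)
  \<comment> \<open>If Maker's edge lies in a member of \<open>Q\<close> that Breaker has not hit,
    he answers inside it; by disjointness there is only one such member. Otherwise any free element
    will do.\<close>
  obtain b where b: "b \<in> X - (insert e M \<union> B)"
    "\<And>q. q \<in> Q \<Longrightarrow> e \<in> q \<Longrightarrow> q \<inter> B = {} \<Longrightarrow> b \<in> q"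
  proof (cases "\<exists>q\<in>Q. e \<in> q \<and> q \<inter> B = {}")
    case True
    then obtain q where q: "q \<in> Q" "e \<in> q" "q \<inter> B = {}" by blast
    then obtain b where "b \<in> q" "b \<noteq> e" using Q(1) by metis
    moreover have "q \<inter> M = {}" using q step.prems(3) by blast
    ultimately have "b \<in> X - (insert e M \<union> B)" using q Q(1) by blast
    moreover have "b \<in> r" if "r \<in> Q" "e \<in> r" for r
      using Q(2)[OF that(1) q(1)] that q \<open>b \<in> q\<close> by blast
    ultimately show ?thesis using that by blast
  next
    case False
    then show ?thesis using step(2) that by blast
  qed
  show ?case
  proof (rule step.IH[OF b(1)])
    fix S assume "S \<in> W"
    then show "S \<inter> insert b B \<noteq> {} \<or> (\<exists>q\<in>Q. q \<subseteq> S)" using step.prems(1) by blast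
  next
    show "insert e M \<inter> insert b B = {}" using step b by blast
  next
    fix q assume "q \<in> Q"
    then show "q \<inter> insert b B \<noteq> {} \<or> q \<inter> insert e M = {}"
      using step.prems(3) b(2) by blast
  qed
qed

text \<open>If Breaker moves outside the embedded board, or to an edge he is already assumed to own,
  Maker pretends that he claimed some other free edge of the smaller board.\<close>

lemma mwin_embed:
  assumes "mwin X W M B" and inj: "inj_on \<phi> X" and X': "\<phi> ` X \<subseteq> X'"
    and W': "\<And>S. S \<in> W \<Longrightarrow> \<phi> ` S \<in> W'"
    and "M \<subseteq> X" "B' \<inter> \<phi> ` X \<subseteq> \<phi> ` (B \<inter> X)"
  shows "mwin X' W' (\<phi> ` M) B'"
  using assms(1,5,6)
proof (induction arbitrary: B')
  case (won S M B)
  then show ?case by (metis W' image_mono mwin.won)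
next
  case (final e M B S)
  have "\<phi> e \<in> X' - (\<phi> ` M \<union> B')"
    using final X' by (auto dest: inj_onD[OF inj])
  then show ?case
    by (rule mwin.final[where S = "\<phi> ` S"]) (use final W' in auto)
next
  case (step e M B)
  have free: "\<phi> x \<in> X' - (insert (\<phi> e) (\<phi> ` M) \<union> B')" if "x \<in> X - (insert e M \<union> B)" for x
    using that step.prems step.hyps(1) X' by (auto dest: inj_onD[OF inj])
  have "\<phi> e \<in> X' - (\<phi> ` M \<union> B')"
    using step X' by (auto dest: inj_onD[OF inj])
  then show ?case
  proof (rule mwin.step)
    show "X' - (insert (\<phi> e) (\<phi> ` M) \<union> B') \<noteq> {}" using step.hyps(2) free by blast
  next
    fix b' assume b': "b' \<in> X' - (insert (\<phi> e) (\<phi> ` M) \<union> B')"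
    show "mwin X' W' (insert (\<phi> e) (\<phi> ` M)) (insert b' B')"
    proof (cases "\<exists>b\<in>X - (insert e M \<union> B). b' = \<phi> b")
      case True
      then obtain b where "b \<in> X - (insert e M \<union> B)" "b' = \<phi> b" by blast
      then show ?thesis using step.IH[of b "insert b' B'"] step.prems step.hyps(1) by auto
    next
      case False
      then have *: "b' \<notin> \<phi> ` X \<or> b' \<in> \<phi> ` (B \<inter> X)" using b' by blast
      obtain b where b: "b \<in> X - (insert e M \<union> B)" using step.hyps(2) by blast
      have "insert b' B' \<inter> \<phi> ` X \<subseteq> \<phi> ` (insert b B \<inter> X)"
        using * step.prems by blast
      then show ?thesis using step.IH[OF b, of "insert b' B'"] step.prems step.hyps(1) by auto
    qed
  qed
qed

section \<open>Opening moves, double threats and forced replies\<close>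

lemma mwin_start:
  assumes "e \<in> X" "X \<noteq> {e}" "\<And>b. b \<in> X \<Longrightarrow> b \<noteq> e \<Longrightarrow> mwin X W {e} {b}"
  shows "mwin X W {} {}"
  by (rule mwin.step[of e]) (use assms in auto)

text \<open>The size bound excludes a win by the opening move itself, so only \<open>step\<close>
  remains and one good answer to each opening is enough.\<close>

lemma mwin_first_move_False:
  assumes "mwin X W {} {}" and "\<And>S. S \<in> W \<Longrightarrow> card S \<ge> 2"
    and "\<And>e. e \<in> X \<Longrightarrow> \<exists>b\<in>X. b \<noteq> e \<and> \<not> mwin X W {e} {b}"
  shows False
  using assms(1)
proof cases
  case (won S)
  then show ?thesis using assms(2) by fastforce
next
  case (final e S)
  then have "card S \<le> 1" using card_mono[of "{e}" S] by simp
  then show ?thesis using assms(2)[of S] final by simp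
next
  case (step e)
  then show ?thesis using assms(3)[of e] by auto
qed

lemma mwin_double_threat:
  assumes "e \<in> X - (M \<union> B)" "g \<in> X - (insert e M \<union> B)" "h \<in> X - (insert e M \<union> B)" "g \<noteq> h"
    and "S \<in> W" "S \<subseteq> insert g (insert e M)" "T \<in> W" "T \<subseteq> insert h (insert e M)"
  shows "mwin X W M B"
proof (rule mwin.step[OF assms(1)])
  show "X - (insert e M \<union> B) \<noteq> {}" using assms by blast
  fix b assume b: "b \<in> X - (insert e M \<union> B)"
  show "mwin X W (insert e M) (insert b B)"
  proof (cases "b = g")
    case True
    then show ?thesis using assms by (intro mwin.final[of h _ _ _ T]) auto
  next
    case False
    then show ?thesis using assms by (intro mwin.final[of g _ _ _ S]) auto
  qed
qed

lemma mwin_forced: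
  assumes "e \<in> X - (M \<union> B)" "g \<in> X - (insert e M \<union> B)"
    and "S \<in> W" "S \<subseteq> insert g (insert e M)"
    and "mwin X W (insert e M) (insert g B)"
  shows "mwin X W M B"
proof (rule mwin.step[OF assms(1)])
  show "X - (insert e M \<union> B) \<noteq> {}" using assms by blast
  fix b assume b: "b \<in> X - (insert e M \<union> B)"
  show "mwin X W (insert e M) (insert b B)"
  proof (cases "b = g")
    case True
    then show ?thesis using assms by simp
  next
    case False
    then show ?thesis using assms by (intro mwin.final[of g _ _ _ S]) auto
  qed
qed

section \<open>The P4 game: pairings at vertices of degree two\<close>

lemma finite_uedges:
  assumes "finite_simple_graph G"
  shows "finite (uedges G)"
proof -
  have "uedges G \<subseteq> Pow (uverts G)" using assms by (auto simp: finite_simple_graph_def)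
  then show ?thesis
    using assms by (auto simp: finite_simple_graph_def intro: finite_subset)
qed

lemma edge_endpoints:
  assumes "finite_simple_graph G" "{u, v} \<in> uedges G"
  shows "u \<in> uverts G" "v \<in> uverts G" "u \<noteq> v"
  using assms by (auto simp: finite_simple_graph_def)

lemma edge_obtain:
  assumes "finite_simple_graph G" "e \<in> uedges G" "u \<in> e"
  obtains v where "e = {u, v}" "u \<noteq> v"
proof -
  have "card e = 2" using assms by (simp add: finite_simple_graph_def)
  then obtain x y where "e = {x, y}" "x \<noteq> y" by (auto simp: card_2_iff)
  then show ?thesis using that assms(3) by (metis doubleton_eq_iff insertE singletonD)
qed

lemma breaker_wins_P4_game_iff:
  assumes "finite_simple_graph G"
  shows "breaker_wins_P4_game G \<longleftrightarrow> \<not> mwin (uedges G) (P4_winning_sets G) {} {}"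
  unfolding breaker_wins_P4_game_def
  by (rule breaker_has_winning_strategy_iff[OF finite_uedges[OF assms]])

lemma path_edges_4: "uedges (path_ugraph 4) = {{0, 1}, {1, 2}, {2, 3}}"
proof -
  have "{i::nat. Suc i < 4} = {0, 1, 2}" by auto
  then have "(\<lambda>i. {i, Suc i}) ` {i. Suc i < 4} = {{0, 1}, {1, 2}, {2, 3::nat}}"
    by (simp add: numeral_eq_Suc)
  then show ?thesis unfolding path_ugraph_def setcompr_eq_image by simp
qed

lemma P4_winning_setsI:
  assumes G: "finite_simple_graph G" and d: "distinct [a, b, c, d]"
    and E: "{a, b} \<in> uedges G" "{b, c} \<in> uedges G" "{c, d} \<in> uedges G"
  shows "{{a, b}, {b, c}, {c, d}} \<in> P4_winning_sets G"
proof -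
  let ?H = "\<lparr>uverts = {a, b, c, d}, uedges = {{a, b}, {b, c}, {c, d}}\<rparr>"
  let ?f = "(\<lambda>_. 0::nat)(b := 1, c := 2, d := 3)"
  have "is_subgraph ?H G"
    using d E edge_endpoints[OF G E(1)] edge_endpoints[OF G E(2)] edge_endpoints[OF G E(3)]
    by (auto simp: is_subgraph_def finite_simple_graph_def)
  moreover have "bij_betw ?f (uverts ?H) (uverts (path_ugraph 4))"
    using d by (auto simp: bij_betw_def inj_on_def path_ugraph_def)
  moreover have "\<forall>u\<in>uverts ?H. \<forall>v\<in>uverts ?H.
      {u, v} \<in> uedges ?H \<longleftrightarrow> {?f u, ?f v} \<in> uedges (path_ugraph 4)"
    unfolding path_edges_4 using d by (simp add: doubleton_eq_iff) auto
  ultimately have "is_subgraph ?H G \<and> isomorphic_ugraph ?H (path_ugraph 4)"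
    unfolding isomorphic_ugraph_def by metis
  then have "uedges ?H \<in> P4_winning_sets G" unfolding P4_winning_sets_def by blast
  then show ?thesis by simp
qed

lemma P4_winning_setsE:
  assumes "S \<in> P4_winning_sets G"
  obtains a b c d where "distinct [a, b, c, d]" "S = {{a, b}, {b, c}, {c, d}}"
    "{a, b} \<in> uedges G" "{b, c} \<in> uedges G" "{c, d} \<in> uedges G"
proof -
  obtain H f where H: "S = uedges H" "is_subgraph H G"
    and f: "bij_betw f (uverts H) {..<4::nat}"
    and E: "\<And>u v. u \<in> uverts H \<Longrightarrow> v \<in> uverts H \<Longrightarrow>
      {u, v} \<in> uedges H \<longleftrightarrow> {f u, f v} \<in> {{0, 1}, {1, 2}, {2, 3}}"
  proof -
    obtain H where "S = uedges H" "is_subgraph H G" "isomorphic_ugraph H (path_ugraph 4)"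
      using assms unfolding P4_winning_sets_def by blast
    moreover have "uverts (path_ugraph 4) = {..<4}" by (simp add: path_ugraph_def)
    ultimately show ?thesis using that unfolding isomorphic_ugraph_def path_edges_4 by metis
  qed
  define g where "g = inv_into (uverts H) f"
  have g: "g i \<in> uverts H" "f (g i) = i" if "i < 4" for i
    using f that unfolding g_def
    by (metis bij_betw_imp_surj_on inv_into_into lessThan_iff,
        metis bij_betw_inv_into_right lessThan_iff)
  have gf: "u = g (f u)" "f u < 4" if "u \<in> uverts H" for u
    using f that unfolding g_def by (metis bij_betw_inv_into_left, metis bij_betw_apply lessThan_iff)
  have S: "S = {{g 0, g 1}, {g 1, g 2}, {g 2, g 3}}"
  proof
    have "{g i, g j} \<in> S" if "i < 4" "j < 4" "{i, j} \<in> {{0, 1}, {1, 2}, {2, 3}}" for i j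
      unfolding H(1) E[OF g(1)[OF that(1)] g(1)[OF that(2)]] g(2)[OF that(1)] g(2)[OF that(2)]
      by (rule that(3))
    from this[of 0 1] this[of 1 2] this[of 2 3]
    show "{{g 0, g 1}, {g 1, g 2}, {g 2, g 3}} \<subseteq> S" by simp
    show "S \<subseteq> {{g 0, g 1}, {g 1, g 2}, {g 2, g 3}}"
    proof
      fix e assume e: "e \<in> S"
      then obtain u v where uv: "e = {u, v}" "u \<in> uverts H" "v \<in> uverts H"
        using H by (fastforce simp: is_subgraph_def finite_simple_graph_def card_2_iff)
      have "{f u, f v} \<in> {{0, 1}, {1, 2}, {2, 3}}" using E[OF uv(2,3)] e unfolding H(1) uv(1) by (rule iffD1)
      moreover have "g ` {f u, f v} = e"
        by (simp add: uv(1) gf(1)[OF uv(2), symmetric] gf(1)[OF uv(3), symmetric])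
      ultimately have "e \<in> image g ` {{0, 1}, {1, 2}, {2, 3}}" by (metis imageI)
      then show "e \<in> {{g 0, g 1}, {g 1, g 2}, {g 2, g 3}}" by simp
    qed
  qed
  have "g i \<noteq> g j" if "i < 4" "j < 4" "i \<noteq> j" for i j using g(2) that by metis
  then have dist: "distinct [g 0, g 1, g 2, g 3]" by simp
  have "S \<subseteq> uedges G" using H by (simp add: is_subgraph_def)
  then have "{g 0, g 1} \<in> uedges G" "{g 1, g 2} \<in> uedges G" "{g 2, g 3} \<in> uedges G"
    unfolding S by simp_all
  then show ?thesis by (rule that[OF dist S])
qed

text \<open>A path with an inner vertex in \<open>I\<close> uses both edges at that vertex, so
  Breaker pairs these two; independence of \<open>I\<close> keeps the pairs disjoint. Paths with no
  inner vertex in \<open>I\<close> must already be hit by \<open>B\<close>. Allowing nonempty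
  \<open>M\<close> and \<open>B\<close> serves odd cycles, where a first exchange precedes the
  pairing.\<close>

lemma not_mwin_vertex_pairing:
  assumes G: "finite_simple_graph G" and "M \<inter> B = {}"
    and deg: "\<And>v. v \<in> I \<Longrightarrow> udegree G v \<le> 2"
    and indep: "\<And>e u v. e \<in> uedges G \<Longrightarrow> u \<in> I \<Longrightarrow> v \<in> I \<Longrightarrow> u \<in> e \<Longrightarrow> v \<in> e \<Longrightarrow> u = v"
    and M: "\<And>v e. v \<in> I \<Longrightarrow> e \<in> M \<Longrightarrow> v \<notin> e"
    and B: "\<And>a b c d. distinct [a, b, c, d] \<Longrightarrow> {a, b} \<in> uedges G \<Longrightarrow> {b, c} \<in> uedges G \<Longrightarrow>
      {c, d} \<in> uedges G \<Longrightarrow> b \<notin> I \<Longrightarrow> c \<notin> I \<Longrightarrow> {{a, b}, {b, c}, {c, d}} \<inter> B \<noteq> {}"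
  shows "\<not> mwin (uedges G) (P4_winning_sets G) M B"
proof
  define inc where "inc v = {e \<in> uedges G. v \<in> e}" for v
  have pair: "inc v = {{a, v}, {v, c}}"
    if "v \<in> I" "{a, v} \<in> uedges G" "{v, c} \<in> uedges G" "a \<noteq> c" for a v c
  proof -
    have "{{a, v}, {v, c}} \<subseteq> inc v" using that by (auto simp: inc_def)
    moreover have "card {{a, v}, {v, c}} = 2" using that(4) by (auto simp: card_insert_if doubleton_eq_iff)
    moreover have "card (inc v) \<le> 2" using deg[OF that(1)] by (simp add: udegree_def inc_def)
    moreover have "finite (inc v)" using finite_uedges[OF G] by (simp add: inc_def)
    ultimately show ?thesis by (metis card_seteq)
  qed
  assume "mwin (uedges G) (P4_winning_sets G) M B"
  then show False
  \<comment> \<open>Vertices of degree below 2 contribute no pair; they are never inner vertices of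
    a path.\<close>
  proof (rule mwin_pairing_False[where Q = "{inc v | v. v \<in> I \<and> card (inc v) = 2}"])
    fix q assume "q \<in> {inc v | v. v \<in> I \<and> card (inc v) = 2}"
    then show "q \<subseteq> uedges G \<and> (\<exists>x\<in>q. \<exists>y\<in>q. x \<noteq> y)" "q \<inter> B \<noteq> {} \<or> q \<inter> M = {}"
      using M by (auto simp: inc_def card_2_iff)
  next
    fix q r
    assume "q \<in> {inc v | v. v \<in> I \<and> card (inc v) = 2}" "r \<in> {inc v | v. v \<in> I \<and> card (inc v) = 2}"
      "q \<inter> r \<noteq> {}"
    then obtain u v e where uv: "u \<in> I" "v \<in> I" "q = inc u" "r = inc v" "e \<in> inc u" "e \<in> inc v"
      by blast
    then have "u = v" using indep[of e u v] by (simp add: inc_def)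
    then show "q = r" using uv by simp
  next
    fix S assume "S \<in> P4_winning_sets G"
    then obtain a b c d where S: "distinct [a, b, c, d]" "S = {{a, b}, {b, c}, {c, d}}"
      "{a, b} \<in> uedges G" "{b, c} \<in> uedges G" "{c, d} \<in> uedges G"
      by (rule P4_winning_setsE)
    have two: "card {{x, y}, {y, z}} = 2" if "x \<noteq> z" for x y z :: 'a
      using that by (auto simp: card_insert_if doubleton_eq_iff)
    have "\<exists>q\<in>{inc v | v. v \<in> I \<and> card (inc v) = 2}. q \<subseteq> S" if "b \<in> I"
      by (rule bexI[of _ "inc b"]) (use pair[OF that S(3,4)] S(1) two[of a c b] that S(2) in auto)
    moreover have "\<exists>q\<in>{inc v | v. v \<in> I \<and> card (inc v) = 2}. q \<subseteq> S" if "c \<in> I"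
      by (rule bexI[of _ "inc c"]) (use pair[OF that S(4,5)] S(1) two[of b d c] that S(2) in auto)
    ultimately show "S \<inter> B \<noteq> {} \<or> (\<exists>q\<in>{inc v | v. v \<in> I \<and> card (inc v) = 2}. q \<subseteq> S)"
      using B[OF S(1,3,4,5)] S(2) by blast
  qed (use assms in auto)
qed

lemma not_mwin_bipartite:
  assumes "finite_simple_graph G" "is_bipartition G A B" "\<And>v. v \<in> B \<Longrightarrow> udegree G v \<le> 2"
  shows "\<not> mwin (uedges G) (P4_winning_sets G) {} {}"
proof (rule not_mwin_vertex_pairing[where I = B, OF assms(1) _ assms(3)])
  fix e u v assume "e \<in> uedges G" "u \<in> B" "v \<in> B" "u \<in> e" "v \<in> e"
  moreover from this obtain a b where "a \<in> A" "e = {a, b}"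
    using assms(2) unfolding is_bipartition_def by metis
  moreover have "A \<inter> B = {}" using assms(2) by (simp add: is_bipartition_def)
  ultimately show "u = v" by auto
next
  \<comment> \<open>The part \<open>B\<close> meets every edge, in particular the middle edge of a
    path, so this case is void.\<close>
  fix a b c d assume "{b, c} \<in> uedges G" "b \<notin> B" "c \<notin> B"
  moreover from this obtain x y where "y \<in> B" "{b, c} = {x, y}"
    using assms(2) unfolding is_bipartition_def by metis
  ultimately show "{{a, b}, {b, c}, {c, d}} \<inter> {} \<noteq> {}" by (metis doubleton_eq_iff)
qed auto

text \<open>Cyclic successor; in contrast to \<open>Suc i mod n\<close> it is accessible to linear arithmetic.\<close>

definition nxt :: "nat \<Rightarrow> nat \<Rightarrow> nat" where
  "nxt n i = (if Suc i = n then 0 else Suc i)"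

section \<open>Breaker on odd cycles\<close>

definition induced_cycle :: "'a ugraph \<Rightarrow> nat \<Rightarrow> (nat \<Rightarrow> 'a) \<Rightarrow> bool" where
  "induced_cycle G n p \<longleftrightarrow> n \<ge> 3 \<and> inj_on p {..<n} \<and> p ` {..<n} \<subseteq> uverts G \<and>
     (\<forall>i<n. \<forall>j<n. {p i, p j} \<in> uedges G \<longleftrightarrow> j = nxt n i \<or> i = nxt n j)"

text \<open>Allows later arguments to assume that the vertex or edge of interest sits at position
  0.\<close>

lemma induced_cycle_rotate:
  assumes "induced_cycle G n p" "i < n"
  obtains q where "induced_cycle G n q" "q ` {..<n} = p ` {..<n}"
    "\<And>j. j < n \<Longrightarrow> q j = p (if i + j < n then i + j else i + j - n)"
proof -
  define r where "r j = (if i + j < n then i + j else i + j - n)" for j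
  have r: "r j < n" "r j = r k \<longleftrightarrow> j = k" "r j = nxt n (r k) \<longleftrightarrow> j = nxt n k"
    if "j < n" "k < n" for j k
    using that assms(2) unfolding r_def nxt_def by (auto split: if_splits)
  have "inj_on r {..<n}" using r(2) by (auto simp: inj_on_def)
  moreover have sub: "r ` {..<n} \<subseteq> {..<n}" using r(1) by auto
  ultimately have im: "r ` {..<n} = {..<n}" by (metis endo_inj_surj finite_lessThan)
  have "induced_cycle G n (\<lambda>j. p (r j))"
    unfolding induced_cycle_def
  proof (intro conjI allI impI)
    show "inj_on (\<lambda>j. p (r j)) {..<n}"
      using assms(1) r(1,2) unfolding induced_cycle_def inj_on_def by (metis lessThan_iff)
    show "(\<lambda>j. p (r j)) ` {..<n} \<subseteq> uverts G"
      using assms(1) r(1) unfolding induced_cycle_def by fast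
    show "{p (r j), p (r k)} \<in> uedges G \<longleftrightarrow> k = nxt n j \<or> j = nxt n k" if "j < n" "k < n" for j k
      using assms(1) r that unfolding induced_cycle_def by metis
  qed (use assms in \<open>simp add: induced_cycle_def\<close>)
  moreover have "(\<lambda>j. p (r j)) ` {..<n} = p ` {..<n}" using im by (metis image_image)
  ultimately show ?thesis by (rule that) (simp add: r_def)
qed

text \<open>As n is odd, position n - 1 is even, so the only cycle edges without an end in 4, 6,
  ..., n - 1 are 01, 12 and 23. A path with one of these in the middle contains 12: from 01 it must
  continue beyond 1, from 23 beyond 2.\<close>

lemma odd_cycle_path_indices:
  assumes "odd n" and less: "h < n" "i < n" "j < n" "l < n" and dist: "distinct [h, i, j, l]"
    and adj: "i = nxt n h \<or> h = nxt n i" "j = nxt n i \<or> i = nxt n j" "l = nxt n j \<or> j = nxt n l"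
    and I: "\<not> (even i \<and> 4 \<le> i)" "\<not> (even j \<and> 4 \<le> j)"
  shows "h = 1 \<and> i = 2 \<or> h = 2 \<and> i = 1 \<or> i = 1 \<and> j = 2 \<or> i = 2 \<and> j = 1 \<or>
    j = 1 \<and> l = 2 \<or> j = 2 \<and> l = 1"
proof -
  \<comment> \<open>Four distinct indices below \<open>n\<close> are given, so a triangle satisfies
    the claim vacuously.\<close>
  have "n \<noteq> 3" using less dist by auto
  moreover have "n \<noteq> 1" using less dist by auto
  ultimately have n: "n > 4" using \<open>odd n\<close> by presburger
  have mid: "x < 3 \<and> y = Suc x" if "y = nxt n x" "x < n" "\<not> (even x \<and> 4 \<le> x)" "\<not> (even y \<and> 4 \<le> y)"
    for x y
    using that n \<open>odd n\<close> unfolding nxt_def by (auto split: if_splits)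
  have small: "y = Suc x \<or> x = Suc y" if "y = nxt n x \<or> x = nxt n y" "0 < x" "x < 4" "x < n" for x y
    using that n by (auto simp: nxt_def split: if_splits)
  from adj(2) show ?thesis
  proof
    assume "j = nxt n i"
    then have "i < 3" "j = Suc i" using mid less I by metis+
    then consider "i = 0" "j = 1" | "i = 1" "j = 2" | "i = 2" "j = 3" by linarith
    then show ?thesis
      by cases (use small[of l 1] small[of h 2] adj(1,3) dist less in auto)
  next
    assume "i = nxt n j"
    then have "j < 3" "i = Suc j" using mid less I by metis+
    then consider "j = 0" "i = 1" | "j = 1" "i = 2" | "j = 2" "i = 3" by linarith
    then show ?thesis
      by cases (use small[of l 2] small[of h 1] adj(1,3) dist less in auto)
  qed
qed

text \<open>After rotation Maker's opening edge is \<open>{q 0, q 1}\<close>. Breaker answers with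
  \<open>{q 1, q 2}\<close> and then pairs the edges at \<open>q 4\<close>, \<open>q 6\<close>, ...,
  \<open>q (n - 1)\<close>. This set is independent because it leaves out position 0, it avoids
  Maker's edge, and each path with no inner vertex in it contains Breaker's edge.\<close>

lemma not_mwin_odd_cycle:
  assumes G: "finite_simple_graph G" and p: "induced_cycle G n p" and V: "uverts G = p ` {..<n}"
    and "odd n"
  shows "\<not> mwin (uedges G) (P4_winning_sets G) {} {}"
proof
  assume "mwin (uedges G) (P4_winning_sets G) {} {}"
  then show False
  proof (rule mwin_first_move_False)
    fix S assume "S \<in> P4_winning_sets G"
    then obtain a b c d where "distinct [a, b, c, d]" "S = {{a, b}, {b, c}, {c, d}}"
      by (rule P4_winning_setsE)
    then show "card S \<ge> 2" by (auto simp: card_insert_if doubleton_eq_iff)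
  next
    fix e assume e: "e \<in> uedges G"
    then have "card e = 2" "e \<subseteq> uverts G" using G by (auto simp: finite_simple_graph_def)
    then obtain i j where ij: "i < n" "j < n" "e = {p i, p j}"
      unfolding V card_2_iff by auto
    then have "j = nxt n i \<or> i = nxt n j" using p e by (auto simp: induced_cycle_def)
    then obtain k where k: "k < n" "e = {p k, p (nxt n k)}" using ij by (auto simp: insert_commute)
    obtain q where q: "induced_cycle G n q" "q ` {..<n} = p ` {..<n}"
      "\<And>j. j < n \<Longrightarrow> q j = p (if k + j < n then k + j else k + j - n)"
      using induced_cycle_rotate[OF p k(1)] by metis
    have n: "n \<ge> 3" and inj: "inj_on q {..<n}"
      and adj: "\<And>i j. i < n \<Longrightarrow> j < n \<Longrightarrow> {q i, q j} \<in> uedges G \<longleftrightarrow> j = nxt n i \<or> i = nxt n j"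
      using q(1) by (auto simp: induced_cycle_def)
    have e01: "e = {q 0, q 1}"
      using q(3)[of 0] q(3)[of 1] n k by (auto simp: nxt_def)
    have qeq: "q i = q j \<longleftrightarrow> i = j" if "i < n" "j < n" for i j
      using inj that by (auto simp: inj_on_def)
    define I where "I = q ` {k. even k \<and> 4 \<le> k \<and> k < n}"
    have qI: "q i \<in> I \<longleftrightarrow> even i \<and> 4 \<le> i" if "i < n" for i
      using qeq that by (auto simp: I_def)
    have vert: "\<exists>i<n. v = q i" if "v \<in> uverts G" for v
      using that unfolding V q(2)[symmetric] by blast
    have "\<not> mwin (uedges G) (P4_winning_sets G) {e} {{q 1, q 2}}"
    proof (rule not_mwin_vertex_pairing[OF G, where I = I])
      show "{e} \<inter> {{q 1, q 2}} = {}"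
        unfolding e01 using n qeq[of 0 1] qeq[of 0 2] by (auto simp: doubleton_eq_iff)
    next
      fix v assume "v \<in> I"
      then obtain m where m: "v = q m" "4 \<le> m" "m < n" by (auto simp: I_def)
      have "{e \<in> uedges G. v \<in> e} \<subseteq> {{q (m - 1), q m}, {q m, q (nxt n m)}}"
      proof
        fix e assume "e \<in> {e \<in> uedges G. v \<in> e}"
        then have e: "e \<in> uedges G" "v \<in> e" by auto
        then obtain x where x: "e = {v, x}" using edge_obtain[OF G] by metis
        then obtain j where "j < n" "x = q j" using vert edge_endpoints(2)[OF G] e by metis
        then have "j = nxt n m \<or> m = nxt n j" "e = {q m, q j}"
          using adj[OF m(3)] e(1) x m(1) by auto
        then show "e \<in> {{q (m - 1), q m}, {q m, q (nxt n m)}}"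
          using m by (auto simp: nxt_def insert_commute split: if_splits)
      qed
      then have "udegree G v \<le> card {{q (m - 1), q m}, {q m, q (nxt n m)}}"
        unfolding udegree_def by (intro card_mono) auto
      also have "\<dots> \<le> 2" by (simp add: card_insert_if)
      finally show "udegree G v \<le> 2" .
    next
      fix e u v assume a: "e \<in> uedges G" "u \<in> I" "v \<in> I" "u \<in> e" "v \<in> e"
      show "u = v"
      proof (rule ccontr)
        assume "u \<noteq> v"
        then have "{u, v} \<in> uedges G" using edge_obtain[OF G a(1,4)] a(1,5)
          by (metis insertE singletonD)
        moreover obtain i j where ij: "u = q i" "v = q j" "i < n" "j < n"
          "even i" "even j" "4 \<le> i" "4 \<le> j"
          using a(2,3) by (auto simp: I_def)
        ultimately have "j = nxt n i \<or> i = nxt n j" using adj by auto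
        then show False using ij by (auto simp: nxt_def split: if_splits)
      qed
    next
      fix v f assume "v \<in> I" "f \<in> {e}"
      then show "v \<notin> f" unfolding e01 using qeq n by (auto simp: I_def)
    next
      fix a b c d
      assume dist: "distinct [a, b, c, d]"
        and E: "{a, b} \<in> uedges G" "{b, c} \<in> uedges G" "{c, d} \<in> uedges G"
        and bc: "b \<notin> I" "c \<notin> I"
      obtain h i j l where idx: "h < n" "i < n" "j < n" "l < n" "a = q h" "b = q i" "c = q j" "d = q l"
        using vert edge_endpoints[OF G E(1)] edge_endpoints[OF G E(3)] by metis
      have "i = nxt n h \<or> h = nxt n i" "j = nxt n i \<or> i = nxt n j" "l = nxt n j \<or> j = nxt n l"
        "\<not> (even i \<and> 4 \<le> i)" "\<not> (even j \<and> 4 \<le> j)" "distinct [h, i, j, l]"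
        using adj E bc dist qI idx by auto
      then have "h = 1 \<and> i = 2 \<or> h = 2 \<and> i = 1 \<or> i = 1 \<and> j = 2 \<or> i = 2 \<and> j = 1 \<or>
          j = 1 \<and> l = 2 \<or> j = 2 \<and> l = 1"
        using odd_cycle_path_indices[OF \<open>odd n\<close>, of h i j l] idx(1-4) by metis
      then show "{{a, b}, {b, c}, {c, d}} \<inter> {{q 1, q 2}} \<noteq> {}"
        unfolding idx(5-8) by (auto simp: insert_commute)
    qed
    moreover have w: "{q 1, q 2} \<in> uedges G" using adj[of 1 2] n by (simp add: nxt_def)
    moreover have "{q 1, q 2} \<noteq> e"
      unfolding e01 using n qeq[of 0 1] qeq[of 0 2] by (auto simp: doubleton_eq_iff)
    ultimately show "\<exists>b\<in>uedges G. b \<noteq> e \<and> \<not> mwin (uedges G) (P4_winning_sets G) {e} {b}"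
      using bexI[of _ "{q 1, q 2}", OF _ w] by metis
  qed
qed

section \<open>Three exceptional graphs\<close>

lemma mwin_reply_pairing_False:
  assumes "mwin X W {e} {b}" "e \<noteq> b" "e \<notin> \<Union>Q"
    and "\<And>q. q \<in> Q \<Longrightarrow> q \<subseteq> X \<and> (\<exists>x\<in>q. \<exists>y\<in>q. x \<noteq> y)"
    and "\<And>q r. q \<in> Q \<Longrightarrow> r \<in> Q \<Longrightarrow> q \<inter> r \<noteq> {} \<Longrightarrow> q = r"
    and "\<And>S. S \<in> W \<Longrightarrow> b \<in> S \<or> (\<exists>q\<in>Q. q \<subseteq> S)"
  shows False
  using assms(1)
proof (rule mwin_pairing_False[where Q = Q])
  show "S \<inter> {b} \<noteq> {} \<or> (\<exists>q\<in>Q. q \<subseteq> S)" if "S \<in> W" for S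
    using assms(6)[OF that] by blast
  show "q \<inter> {b} \<noteq> {} \<or> q \<inter> {e} = {}" if "q \<in> Q" for q using assms(3) that by blast
qed (use assms(2,4,5) in auto)

lemma not_mwin_reply_two_pairs:
  assumes "distinct [e, b, x1, y1, x2, y2]" "{x1, y1, x2, y2} \<subseteq> X"
    and "\<And>S. S \<in> W \<Longrightarrow> b \<in> S \<or> {x1, y1} \<subseteq> S \<or> {x2, y2} \<subseteq> S"
  shows "\<not> mwin X W {e} {b}"
proof
  assume "mwin X W {e} {b}"
  then show False
    by (rule mwin_reply_pairing_False[where Q = "{{x1, y1}, {x2, y2}}"]) (use assms in auto)
qed

lemma not_mwin_reply_one_pair:
  assumes "distinct [e, b, x, y]" "{x, y} \<subseteq> X"
    and "\<And>S. S \<in> W \<Longrightarrow> b \<in> S \<or> {x, y} \<subseteq> S"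
  shows "\<not> mwin X W {e} {b}"
proof
  assume "mwin X W {e} {b}"
  then show False
    by (rule mwin_reply_pairing_False[where Q = "{{x, y}}"]) (use assms in auto)
qed

text \<open>A subgraph may drop edges, so the equivalence required of an isomorphism onto it weakens
  to preservation of edges into \<open>H\<close>. The image of \<open>G\<close> is the subgraph that
  witnesses this.\<close>

lemma isomorphic_to_subgraph_of_iff:
  assumes G: "finite_simple_graph G" and H: "finite_simple_graph H"
  shows "isomorphic_to_subgraph_of G H \<longleftrightarrow>
    (\<exists>f. inj_on f (uverts G) \<and> f ` uverts G \<subseteq> uverts H \<and> (\<forall>e\<in>uedges G. f ` e \<in> uedges H))"
proof
  assume "isomorphic_to_subgraph_of G H"
  then obtain H' f where H': "is_subgraph H' H" and f: "bij_betw f (uverts G) (uverts H')"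
    and E: "\<And>u v. u \<in> uverts G \<Longrightarrow> v \<in> uverts G \<Longrightarrow> {u, v} \<in> uedges G \<longleftrightarrow> {f u, f v} \<in> uedges H'"
    unfolding isomorphic_to_subgraph_of_def isomorphic_ugraph_def by metis
  have "f ` e \<in> uedges H" if "e \<in> uedges G" for e
  proof -
    have "card e = 2" using G that by (simp add: finite_simple_graph_def)
    then obtain u v where uv: "e = {u, v}" by (auto simp: card_2_iff)
    then have "{f u, f v} \<in> uedges H'"
      using E[of u v] edge_endpoints[OF G, of u v] that by simp
    then show ?thesis using H' uv by (auto simp: is_subgraph_def)
  qed
  then show "\<exists>f. inj_on f (uverts G) \<and> f ` uverts G \<subseteq> uverts H \<and> (\<forall>e\<in>uedges G. f ` e \<in> uedges H)"
    using f H' by (intro exI[of _ f]) (auto simp: bij_betw_def is_subgraph_def)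
next
  assume "\<exists>f. inj_on f (uverts G) \<and> f ` uverts G \<subseteq> uverts H \<and> (\<forall>e\<in>uedges G. f ` e \<in> uedges H)"
  then obtain f where f: "inj_on f (uverts G)" "f ` uverts G \<subseteq> uverts H"
    "\<And>e. e \<in> uedges G \<Longrightarrow> f ` e \<in> uedges H" by blast
  let ?H' = "\<lparr>uverts = f ` uverts G, uedges = image f ` uedges G\<rparr>"
  have "x \<in> uverts G" if "e \<in> uedges G" "x \<in> e" for e x
    using G that by (auto simp: finite_simple_graph_def)
  then have "is_subgraph ?H' H"
    using G H f(2,3) by (auto simp: is_subgraph_def finite_simple_graph_def)
  moreover have "{u, v} \<in> uedges G \<longleftrightarrow> {f u, f v} \<in> uedges ?H'"
    if "u \<in> uverts G" "v \<in> uverts G" for u v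
  proof
    assume "{f u, f v} \<in> uedges ?H'"
    then obtain e where e: "e \<in> uedges G" "f ` {u, v} = f ` e" by auto
    then have "{u, v} = e"
      using inj_on_image_eq_iff[OF f(1), of "{u, v}" e] that G by (auto simp: finite_simple_graph_def)
    then show "{u, v} \<in> uedges G" using e by simp
  next
    assume "{u, v} \<in> uedges G"
    then have "f ` {u, v} \<in> image f ` uedges G" by (rule imageI)
    then show "{f u, f v} \<in> uedges ?H'" by simp
  qed
  ultimately show "isomorphic_to_subgraph_of G H"
    unfolding isomorphic_to_subgraph_of_def isomorphic_ugraph_def
    using f(1) by (intro exI[of _ ?H'] conjI exI[of _ f]) (auto simp: bij_betw_def)
qed

text \<open>A forced win of Maker survives on any larger board, so the verdict on the three maximal
  graphs settles all their subgraphs.\<close>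

lemma not_mwin_subgraph:
  assumes G: "finite_simple_graph G" and H: "finite_simple_graph H"
    and "isomorphic_to_subgraph_of G H"
    and H_win: "\<not> mwin (uedges H) (P4_winning_sets H) {} {}"
  shows "\<not> mwin (uedges G) (P4_winning_sets G) {} {}"
proof
  obtain f where f: "inj_on f (uverts G)" "f ` uverts G \<subseteq> uverts H"
    "\<And>e. e \<in> uedges G \<Longrightarrow> f ` e \<in> uedges H"
    using assms(3) unfolding isomorphic_to_subgraph_of_iff[OF G H] by blast
  assume "mwin (uedges G) (P4_winning_sets G) {} {}"
  then have "mwin (uedges H) (P4_winning_sets H) (image f ` {}) {}"
  proof (rule mwin_embed)
    show "inj_on (image f) (uedges G)"
      using G inj_on_image_eq_iff[OF f(1)] by (auto simp: inj_on_def finite_simple_graph_def)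
    show "image f ` uedges G \<subseteq> uedges H" using f(3) by blast
    fix S assume "S \<in> P4_winning_sets G"
    then obtain a b c d where S: "distinct [a, b, c, d]" "S = {{a, b}, {b, c}, {c, d}}"
      "{a, b} \<in> uedges G" "{b, c} \<in> uedges G" "{c, d} \<in> uedges G"
      by (rule P4_winning_setsE)
    have "{a, b, c, d} \<subseteq> uverts G" using S(3,5) edge_endpoints[OF G] by auto
    then have "distinct [f a, f b, f c, f d]" using S(1) f(1) by (auto simp: inj_on_eq_iff)
    from P4_winning_setsI[OF H this] f(3)[OF S(3)] f(3)[OF S(4)] f(3)[OF S(5)]
    show "image f ` S \<in> P4_winning_sets H" unfolding S(2) by simp
  qed auto
  then show False using H_win by simp
qed

section \<open>Breaker's replies on the bull, the pentagon with a leaf, and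
  \<open>complete_ugraph 4\<close>\<close>

lemma card_P4_winning_set:
  assumes "S \<in> P4_winning_sets G"
  shows "card S = 3"
proof -
  obtain a b c d where "distinct [a, b, c, d]" "S = {{a, b}, {b, c}, {c, d}}"
    using assms by (rule P4_winning_setsE)
  moreover from this have "{a, b} \<noteq> {b, c}" "{a, b} \<noteq> {c, d}" "{b, c} \<noteq> {c, d}"
    by (auto simp: doubleton_eq_iff)
  ultimately show ?thesis by simp
qed

text \<open>Vertices are abstracted away: \<open>e1\<close> to \<open>e5\<close> run round the cycle
  from the vertex that carries the leaf edge \<open>f\<close>. In every case the reply hits so many
  of the seven triples that each of the others contains one of at most two disjoint pairs of free
  edges. Reflection, exchanging \<open>e1\<close> with \<open>e5\<close> and \<open>e2\<close> with
  \<open>e4\<close>, relates the cases.\<close>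

lemma not_mwin_C5_leaf_board:
  assumes dist: "distinct [e1, e2, e3, e4, e5, f]" and X: "X = {e1, e2, e3, e4, e5, f}"
    and W: "\<And>S. S \<in> W \<Longrightarrow> {e1, e2, e3} \<subseteq> S \<or> {e2, e3, e4} \<subseteq> S \<or> {e3, e4, e5} \<subseteq> S \<or>
      {e4, e5, e1} \<subseteq> S \<or> {e5, e1, e2} \<subseteq> S \<or> {f, e1, e2} \<subseteq> S \<or> {f, e5, e4} \<subseteq> S"
    and card: "\<And>S. S \<in> W \<Longrightarrow> card S = 3"
  shows "\<not> mwin X W {} {}"
proof
  assume "mwin X W {} {}"
  then show False
  proof (rule mwin_first_move_False)
    fix S assume "S \<in> W"
    then show "card S \<ge> 2" using card by fastforce
  next
    fix e assume "e \<in> X"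
    then consider "e = e1" | "e = e2" | "e = e3" | "e = e4" | "e = e5" | "e = f"
      using X by blast
    then show "\<exists>b\<in>X. b \<noteq> e \<and> \<not> mwin X W {e} {b}"
    proof cases
      case 1
      have "\<not> mwin X W {e1} {e2}"
        by (rule not_mwin_reply_one_pair[of _ _ e4 e5]) (use dist X in \<open>auto dest!: W\<close>)
      then show ?thesis using 1 dist X by (intro bexI[of _ e2]) auto
    next
      case 2
      have "\<not> mwin X W {e2} {e1}"
        by (rule not_mwin_reply_two_pairs[of _ _ e3 e4 e5 f]) (use dist X in \<open>auto dest!: W\<close>)
      then show ?thesis using 2 dist X by (intro bexI[of _ e1]) auto
    next
      case 3
      have "\<not> mwin X W {e3} {e2}"
        by (rule not_mwin_reply_one_pair[of _ _ e4 e5]) (use dist X in \<open>auto dest!: W\<close>)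
      then show ?thesis using 3 dist X by (intro bexI[of _ e2]) auto
    next
      case 4
      have "\<not> mwin X W {e4} {e5}"
        by (rule not_mwin_reply_two_pairs[of _ _ e3 e2 e1 f]) (use dist X in \<open>auto dest!: W\<close>)
      then show ?thesis using 4 dist X by (intro bexI[of _ e5]) auto
    next
      case 5
      have "\<not> mwin X W {e5} {e4}"
        by (rule not_mwin_reply_one_pair[of _ _ e1 e2]) (use dist X in \<open>auto dest!: W\<close>)
      then show ?thesis using 5 dist X by (intro bexI[of _ e4]) auto
    next
      case 6
      have "\<not> mwin X W {f} {e1}"
        by (rule not_mwin_reply_two_pairs[of _ _ e2 e3 e4 e5]) (use dist X in \<open>auto dest!: W\<close>)
      then show ?thesis using 6 dist X by (intro bexI[of _ e1]) auto
    qed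
  qed
qed

text \<open>Here \<open>t\<close> joins the two triangle vertices with leaf edges \<open>x\<close>
  and \<open>y\<close>; \<open>p\<close> and \<open>q\<close> join these vertices to the third one.
  After each reply the surviving triples have a common pair of free edges.\<close>

lemma not_mwin_bull_board:
  assumes dist: "distinct [t, p, q, x, y]" and X: "X = {t, p, q, x, y}"
    and W: "\<And>S. S \<in> W \<Longrightarrow> {x, t, y} \<subseteq> S \<or> {x, t, q} \<subseteq> S \<or> {x, p, q} \<subseteq> S \<or>
      {y, t, p} \<subseteq> S \<or> {y, q, p} \<subseteq> S"
    and card: "\<And>S. S \<in> W \<Longrightarrow> card S = 3"
  shows "\<not> mwin X W {} {}"
proof
  assume "mwin X W {} {}"
  then show False
  proof (rule mwin_first_move_False)
    fix S assume "S \<in> W"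
    then show "card S \<ge> 2" using card by fastforce
  next
    fix e assume "e \<in> X"
    then consider "e = t" | "e = p" | "e = q" | "e = x" | "e = y"
      using X by blast
    then show "\<exists>b\<in>X. b \<noteq> e \<and> \<not> mwin X W {e} {b}"
    proof cases
      case 1
      have "\<not> mwin X W {t} {x}"
        by (rule not_mwin_reply_one_pair[of _ _ y p]) (use dist X in \<open>auto dest!: W\<close>)
      then show ?thesis using 1 dist X by (intro bexI[of _ x]) auto
    next
      case 2
      have "\<not> mwin X W {p} {q}"
        by (rule not_mwin_reply_one_pair[of _ _ t y]) (use dist X in \<open>auto dest!: W\<close>)
      then show ?thesis using 2 dist X by (intro bexI[of _ q]) auto
    next
      case 3
      have "\<not> mwin X W {q} {p}"
        by (rule not_mwin_reply_one_pair[of _ _ t x]) (use dist X in \<open>auto dest!: W\<close>)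
      then show ?thesis using 3 dist X by (intro bexI[of _ p]) auto
    next
      case 4
      have "\<not> mwin X W {x} {q}"
        by (rule not_mwin_reply_one_pair[of _ _ t y]) (use dist X in \<open>auto dest!: W\<close>)
      then show ?thesis using 4 dist X by (intro bexI[of _ q]) auto
    next
      case 5
      have "\<not> mwin X W {y} {p}"
        by (rule not_mwin_reply_one_pair[of _ _ t x]) (use dist X in \<open>auto dest!: W\<close>)
      then show ?thesis using 5 dist X by (intro bexI[of _ p]) auto
    qed
  qed
qed

lemma cycle_edges: "uedges (cycle_ugraph n) = (\<lambda>i. {i, Suc i mod n}) ` {..<n}"
  by (auto simp: cycle_ugraph_def)

lemma bull_edges: "uedges bull_ugraph = {{0, 1}, {1, 2}, {0, 2}, {0, 3}, {1, 4}}"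
proof -
  have "{..<3::nat} = {0, 1, 2}" by auto
  then show ?thesis
    by (simp add: bull_ugraph_def attach_leaf_def cycle_edges insert_commute numeral_2_eq_2)
qed

lemma bull_verts: "uverts bull_ugraph = {..<5}"
  by (auto simp: bull_ugraph_def attach_leaf_def cycle_ugraph_def)

lemma C5_with_leaf_edges:
  "uedges C5_with_leaf = {{0, 1}, {1, 2}, {2, 3}, {3, 4}, {0, 4}, {0, 5}}"
proof -
  have "{..<5::nat} = {0, 1, 2, 3, 4}" by auto
  then show ?thesis
    by (simp add: C5_with_leaf_def attach_leaf_def cycle_edges insert_commute numeral_2_eq_2)
qed

lemma C5_with_leaf_verts: "uverts C5_with_leaf = {..<6}"
  by (auto simp: C5_with_leaf_def attach_leaf_def cycle_ugraph_def)

lemma finite_simple_bull: "finite_simple_graph bull_ugraph"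
  by (auto simp: finite_simple_graph_def bull_edges bull_verts)

lemma finite_simple_C5_with_leaf: "finite_simple_graph C5_with_leaf"
  by (auto simp: finite_simple_graph_def C5_with_leaf_edges C5_with_leaf_verts)

lemma finite_simple_complete: "finite_simple_graph (complete_ugraph n)"
  by (auto simp: finite_simple_graph_def complete_ugraph_def)

lemma not_mwin_bull: "\<not> mwin (uedges bull_ugraph) (P4_winning_sets bull_ugraph) {} {}"
proof (rule not_mwin_bull_board)
  show "distinct [{0, 1}, {0, 2}, {1, 2}, {0, 3}, {1, 4 :: nat}]"
    by (simp add: doubleton_eq_iff)
  show "uedges bull_ugraph = {{0, 1}, {0, 2}, {1, 2}, {0, 3}, {1, 4}}"
    by (auto simp: bull_edges)
  fix S assume S: "S \<in> P4_winning_sets bull_ugraph"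
  then show "card S = 3" by (rule card_P4_winning_set)
  from S obtain a b c d where P: "distinct [a, b, c, d]" "S = {{a, b}, {b, c}, {c, d}}"
    "{a, b} \<in> uedges bull_ugraph" "{b, c} \<in> uedges bull_ugraph" "{c, d} \<in> uedges bull_ugraph"
    by (rule P4_winning_setsE)
  have adj: "(x, y) \<in> {(0, 1), (0, 2), (0, 3), (1, 0), (1, 2), (1, 4), (2, 0), (2, 1), (3, 0), (4, 1)}"
    if "{x, y} \<in> uedges bull_ugraph" for x y
    using that unfolding bull_edges by (auto simp: doubleton_eq_iff)
  \<comment> \<open>Five paths, each listed in both directions.\<close>
  have "(a, b, c, d) \<in> {(0, 2, 1, 4), (1, 2, 0, 3), (2, 1, 0, 3), (2, 0, 1, 4),
      (3, 0, 1, 2), (3, 0, 1, 4), (3, 0, 2, 1), (4, 1, 0, 2), (4, 1, 0, 3), (4, 1, 2, 0)}"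
    using adj[OF P(3)]
    by (elim insertE emptyE) (use adj[OF P(4)] adj[OF P(5)] P(1) in \<open>simp; elim disjE; simp\<close>)+
  then show "{{0, 3}, {0, 1}, {1, 4}} \<subseteq> S \<or> {{0, 3}, {0, 1}, {1, 2}} \<subseteq> S \<or>
      {{0, 3}, {0, 2}, {1, 2}} \<subseteq> S \<or> {{1, 4}, {0, 1}, {0, 2}} \<subseteq> S \<or>
      {{1, 4}, {1, 2}, {0, 2}} \<subseteq> S"
    unfolding P(2) by (elim insertE emptyE; simp add: doubleton_eq_iff)
qed

lemma not_mwin_C5_with_leaf:
  "\<not> mwin (uedges C5_with_leaf) (P4_winning_sets C5_with_leaf) {} {}"
proof (rule not_mwin_C5_leaf_board)
  show "distinct [{0, 1}, {1, 2}, {2, 3}, {3, 4}, {0, 4}, {0, 5 :: nat}]"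
    by (simp add: doubleton_eq_iff)
  show "uedges C5_with_leaf = {{0, 1}, {1, 2}, {2, 3}, {3, 4}, {0, 4}, {0, 5}}"
    by (rule C5_with_leaf_edges)
  fix S assume S: "S \<in> P4_winning_sets C5_with_leaf"
  then show "card S = 3" by (rule card_P4_winning_set)
  from S obtain a b c d where P: "distinct [a, b, c, d]" "S = {{a, b}, {b, c}, {c, d}}"
    "{a, b} \<in> uedges C5_with_leaf" "{b, c} \<in> uedges C5_with_leaf" "{c, d} \<in> uedges C5_with_leaf"
    by (rule P4_winning_setsE)
  have adj: "(x, y) \<in> {(0, 1), (0, 4), (0, 5), (1, 0), (1, 2), (2, 1), (2, 3), (3, 2), (3, 4), (4, 0), (4, 3), (5, 0)}"
    if "{x, y} \<in> uedges C5_with_leaf" for x y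
    using that unfolding C5_with_leaf_edges by (auto simp: doubleton_eq_iff)
  \<comment> \<open>Seven paths, each listed in both directions.\<close>
  have "(a, b, c, d) \<in> {(0, 1, 2, 3), (0, 4, 3, 2), (1, 0, 4, 3), (1, 2, 3, 4), (2, 1, 0, 4),
      (2, 1, 0, 5), (2, 3, 4, 0), (3, 2, 1, 0), (3, 4, 0, 1), (3, 4, 0, 5),
      (4, 3, 2, 1), (4, 0, 1, 2), (5, 0, 1, 2), (5, 0, 4, 3)}"
    using adj[OF P(3)]
    by (elim insertE emptyE) (use adj[OF P(4)] adj[OF P(5)] P(1) in \<open>simp; elim disjE; simp\<close>)+
  then show "{{0, 1}, {1, 2}, {2, 3}} \<subseteq> S \<or> {{1, 2}, {2, 3}, {3, 4}} \<subseteq> S \<or>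
      {{2, 3}, {3, 4}, {0, 4}} \<subseteq> S \<or> {{3, 4}, {0, 4}, {0, 1}} \<subseteq> S \<or>
      {{0, 4}, {0, 1}, {1, 2}} \<subseteq> S \<or> {{0, 5}, {0, 1}, {1, 2}} \<subseteq> S \<or>
      {{0, 5}, {0, 4}, {3, 4}} \<subseteq> S"
    unfolding P(2) by (elim insertE emptyE; simp add: doubleton_eq_iff)
qed

text \<open>The two end edges of a spanning path of \<open>K\<^sub>4\<close> are disjoint, so Breaker pairs opposite edges.\<close>

lemma not_mwin_K4:
  "\<not> mwin (uedges (complete_ugraph 4)) (P4_winning_sets (complete_ugraph 4)) {} {}"
proof
  let ?E = "uedges (complete_ugraph 4)"
  let ?Q = "{{e, {..<4} - e} | e. e \<in> ?E}"
  have E: "e \<in> ?E \<longleftrightarrow> e \<subseteq> {..<4} \<and> card e = 2" for e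
    by (auto simp: complete_ugraph_def card_2_iff)
  have compl: "{..<4} - e \<in> ?E" "e \<noteq> {..<4} - e" if "e \<in> ?E" for e
  proof -
    have "finite e" using that E finite_subset by blast
    then show "{..<4} - e \<in> ?E" using that unfolding E by (simp add: card_Diff_subset)
    have "e \<noteq> {}" using that unfolding E by auto
    then show "e \<noteq> {..<4} - e" by blast
  qed
  assume "mwin ?E (P4_winning_sets (complete_ugraph 4)) {} {}"
  then show False
  proof (rule mwin_pairing_False[where Q = ?Q])
    fix q assume "q \<in> ?Q"
    then show "q \<subseteq> ?E \<and> (\<exists>x\<in>q. \<exists>y\<in>q. x \<noteq> y)" using compl by auto
  next
    fix q r assume qr: "q \<in> ?Q" "r \<in> ?Q" "q \<inter> r \<noteq> {}"
    then obtain e f where ef: "e \<in> ?E" "f \<in> ?E" "q = {e, {..<4} - e}" "r = {f, {..<4} - f}"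
      by blast
    then have compl2: "{..<4} - ({..<4} - e) = e" "{..<4} - ({..<4} - f) = f"
      by (auto simp: E double_diff)
    have "e = f \<or> e = {..<4} - f \<or> {..<4} - e = f \<or> {..<4} - e = {..<4} - f"
      using qr(3) unfolding ef(3,4) by blast
    then have "e = f \<or> e = {..<4} - f \<and> {..<4} - e = f" using compl2 by metis
    then show "q = r" unfolding ef(3,4) by auto
  next
    fix S assume "S \<in> P4_winning_sets (complete_ugraph 4)"
    then obtain a b c d where S: "distinct [a, b, c, d]" "S = {{a, b}, {b, c}, {c, d}}"
      "{a, b} \<in> ?E" "{b, c} \<in> ?E" "{c, d} \<in> ?E"
      by (rule P4_winning_setsE)
    have "{a, b, c, d} = {..<4}"
      using S by (intro card_subset_eq) (auto simp: E)
    then have "{c, d} = {..<4} - {a, b}" using S(1) by auto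
    then have "{{a, b}, {c, d}} \<in> ?Q" using S(3) by blast
    moreover have "{{a, b}, {c, d}} \<subseteq> S" using S(2) by simp
    ultimately show "S \<inter> {} \<noteq> {} \<or> (\<exists>q\<in>?Q. q \<subseteq> S)" by blast
  qed auto
qed

section \<open>Winning configurations for Maker\<close>

lemma P4_double_threat:
  assumes G: "finite_simple_graph G" and E: "M \<subseteq> uedges G" "{e, g, h} \<subseteq> uedges G"
    and free: "distinct [e, g, h]" "{e, g, h} \<inter> (M \<union> B) = {}"
    and path1: "distinct [a1, b1, c1, d1]" "{{a1, b1}, {b1, c1}, {c1, d1}} \<subseteq> insert g (insert e M)"
    and path2: "distinct [a2, b2, c2, d2]" "{{a2, b2}, {b2, c2}, {c2, d2}} \<subseteq> insert h (insert e M)"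
  shows "mwin (uedges G) (P4_winning_sets G) M B"
proof (rule mwin_double_threat)
  show "{{a1, b1}, {b1, c1}, {c1, d1}} \<in> P4_winning_sets G"
    using path1 E by (intro P4_winning_setsI[OF G]) auto
  show "{{a2, b2}, {b2, c2}, {c2, d2}} \<in> P4_winning_sets G"
    using path2 E by (intro P4_winning_setsI[OF G]) auto
qed (use E free path1(2) path2(2) in auto)

text \<open>The form used for small graphs: after the opening \<open>e0\<close> and the reply
  \<open>r\<close>, it remains to name a second move \<open>e\<close> and two completing edges
  \<open>g\<close> and \<open>h\<close> that \<open>r\<close> has not taken.\<close>

lemma P4_reply_double_threat:
  assumes G: "finite_simple_graph G" and E: "{e0, e, g, h} \<subseteq> uedges G"
    and free: "distinct [e0, e, g, h]" "r \<notin> {e, g, h}"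
    and path1: "distinct [a1, b1, c1, d1]" "{{a1, b1}, {b1, c1}, {c1, d1}} \<subseteq> {e0, e, g}"
    and path2: "distinct [a2, b2, c2, d2]" "{{a2, b2}, {b2, c2}, {c2, d2}} \<subseteq> {e0, e, h}"
  shows "mwin (uedges G) (P4_winning_sets G) {e0} {r}"
proof (rule P4_double_threat[OF G _ _ _ _ path1(1) _ path2(1)])
  show "{{a1, b1}, {b1, c1}, {c1, d1}} \<subseteq> insert g (insert e {e0})"
    "{{a2, b2}, {b2, c2}, {c2, d2}} \<subseteq> insert h (insert e {e0})"
    using path1(2) path2(2) by auto
qed (use E free in auto)

lemma rope_edges_eq_iff:
  assumes "inj_on f {0..Suc m}" "i \<le> m" "j \<le> m"
  shows "{f i, f (Suc i)} = {f j, f (Suc j)} \<longleftrightarrow> i = j"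
  using assms by (auto simp: doubleton_eq_iff inj_on_eq_iff)

text \<open>Maker owns the first edge of a path of even length whose other edges are free and end in
  two free edges at the last vertex: claiming every second edge forces all of Breaker's replies
  until the last claim makes a double threat.\<close>

lemma mwin_rope:
  fixes G :: "'a ugraph"
  assumes G: "finite_simple_graph G" and "odd m" "inj_on f {0..Suc m}" "M \<subseteq> uedges G"
    and "\<And>i. i \<le> m \<Longrightarrow> {f i, f (Suc i)} \<in> uedges G" "{f 0, f 1} \<in> M"
    and "\<And>i. 1 \<le> i \<Longrightarrow> i \<le> m \<Longrightarrow> {f i, f (Suc i)} \<notin> M \<union> B"
    and "{f (Suc m), y1} \<in> uedges G" "{f (Suc m), y2} \<in> uedges G" "y1 \<noteq> y2"
    and "{f (Suc m), y1} \<notin> M \<union> B" "{f (Suc m), y2} \<notin> M \<union> B"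
    and "y1 \<notin> {f m, f (m - 1)}" "y2 \<notin> {f m, f (m - 1)}"
  shows "mwin (uedges G) (P4_winning_sets G) M B"
  using assms(2-)
proof (induction m arbitrary: f M B rule: less_induct)
  case (less m)
  note inj = less.prems(2) and ME = less.prems(3) and E = less.prems(4) and M0 = less.prems(5)
    and free = less.prems(6)
  have feq: "f i = f j \<longleftrightarrow> i = j" if "i \<le> Suc m" "j \<le> Suc m" for i j
    using inj that by (auto simp: inj_on_eq_iff)
  have y: "f (Suc m) \<noteq> y1" "f (Suc m) \<noteq> y2"
    using edge_endpoints(3)[OF G] less.prems(7,8) by auto
  show ?case
  proof (cases "m = 1")
    case True
    have f: "distinct [f 0, f 1, f 2]" using feq[of 0 1] feq[of 0 2] feq[of 1 2] True by simp
    \<comment> \<open>The final threats are paths through the last three rope vertices and a fan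
      vertex, so these are the only rope vertices that \<open>y1\<close> and \<open>y2\<close> have
      to avoid.\<close>
    show ?thesis
    proof (rule P4_double_threat[OF G ME, where e = "{f 1, f 2}" and g = "{f 2, y1}" and h = "{f 2, y2}"])
      show "distinct [f 0, f 1, f 2, y1]" "distinct [f 0, f 1, f 2, y2]"
        using f y less.prems(12,13) True by (auto simp: numeral_2_eq_2)
      show "{{f 1, f 2}, {f 2, y1}, {f 2, y2}} \<subseteq> uedges G"
        using E[of 1] less.prems(7,8) True by (simp add: numeral_2_eq_2)
      show "distinct [{f 1, f 2}, {f 2, y1}, {f 2, y2}]"
        using f less.prems(9,12,13) True by (auto simp: doubleton_eq_iff numeral_2_eq_2)
      show "{{f 1, f 2}, {f 2, y1}, {f 2, y2}} \<inter> (M \<union> B) = {}"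
        using free[of 1] less.prems(10,11) True by (simp add: numeral_2_eq_2)
    qed (use M0 in \<open>auto simp: numeral_2_eq_2\<close>)
  next
    case False
    then have m: "m \<ge> 3" using less.prems(1) by (auto elim!: oddE)
    have f: "distinct [f 0, f 1, f 2, f 3]"
      using feq[of 0 1] feq[of 0 2] feq[of 0 3] feq[of 1 2] feq[of 1 3] feq[of 2 3] m by simp
    have P4: "{{f 0, f 1}, {f 1, f 2}, {f 2, f 3}} \<in> P4_winning_sets G"
      using E[of 0] E[of 1] E[of 2] m
      by (intro P4_winning_setsI[OF G f]) (simp_all add: numeral_2_eq_2 numeral_3_eq_3)
    let ?e = "{f 2, f 3}" and ?g = "{f 1, f 2}"
    have e: "?e \<in> uedges G - (M \<union> B)" and g: "?g \<in> uedges G - (insert ?e M \<union> B)"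
      using E[of 1] E[of 2] free[of 1] free[of 2] m f
      by (auto simp: numeral_2_eq_2 numeral_3_eq_3 doubleton_eq_iff)
    have e_edge: "?e = {f 2, f (Suc 2)}" "?g = {f 1, f (Suc 1)}"
      by (simp_all add: numeral_2_eq_2 numeral_3_eq_3)
    show ?thesis
    proof (rule mwin_forced[OF e g P4])
      show "{{f 0, f 1}, {f 1, f 2}, {f 2, f 3}} \<subseteq> insert ?g (insert ?e M)" using M0 by auto
      \<comment> \<open>The rest of the rope, from \<open>f 2\<close> on, is shorter by two and
        starts with the edge that Maker has just claimed.\<close>
      obtain k where k: "m = k + 2" using m that[of "m - 2"] by simp
      \<comment> \<open>The fan is centred at \<open>f (Suc m)\<close> with m at least 3, hence off
        \<open>f 1\<close>, \<open>f 2\<close> and \<open>f 3\<close>: the exchange cannot consume a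
        fan edge.\<close>
      have fan: "{f (Suc m), z} \<notin> insert ?e M \<union> insert ?g B" if "{f (Suc m), z} \<notin> M \<union> B" for z
        using that feq[of "Suc m" 1] feq[of "Suc m" 2] feq[of "Suc m" 3] m
        by (auto simp: doubleton_eq_iff)
      show "mwin (uedges G) (P4_winning_sets G) (insert ?e M) (insert ?g B)"
      proof (rule less.IH[of k "\<lambda>i. f (i + 2)"])
        show "inj_on (\<lambda>i. f (i + 2)) {0..Suc k}"
          using feq k by (auto simp: inj_on_def)
        show "{f (i + 2), f (Suc i + 2)} \<in> uedges G" if "i \<le> k" for i
          using E[of "i + 2"] that k by simp
        show "{f (i + 2), f (Suc i + 2)} \<notin> insert ?e M \<union> insert ?g B" if "1 \<le> i" "i \<le> k" for i
          using free[of "i + 2"] that k rope_edges_eq_iff[OF inj, of "i + 2" 2]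
            rope_edges_eq_iff[OF inj, of "i + 2" 1] unfolding e_edge by simp
        show "{f (Suc k + 2), y1} \<notin> insert ?e M \<union> insert ?g B"
          "{f (Suc k + 2), y2} \<notin> insert ?e M \<union> insert ?g B"
          using fan less.prems(10,11) k by auto
        show "k < m" "odd k" using k less.prems(1) by auto
        show "y1 \<notin> {f (k + 2), f (k - 1 + 2)}" "y2 \<notin> {f (k + 2), f (k - 1 + 2)}"
          using k m less.prems(12,13) by (auto simp: Suc_diff_Suc)
        show "insert ?e M \<subseteq> uedges G" using ME e by blast
        show "{f (0 + 2), f (1 + 2)} \<in> insert ?e M" by (simp add: numeral_3_eq_3 numeral_2_eq_2)
      qed (use less.prems(7,8,9) k in auto)
    qed
  qed
qed

text \<open>Maker opens with the second edge of the path. If Breaker takes the first, the path from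
  \<open>f 1\<close> to \<open>f d\<close> has even length d - 1 and is a rope. Otherwise claiming
  \<open>{f 0, f 1}\<close> leaves three completing edges, the two at \<open>f 0\<close> and
  \<open>{f 2, f 3}\<close>, of which Breaker owns at most one. Injectivity is asked only from index
  1 on, so \<open>f 0 = f d\<close> is possible and the path may run once around an odd
  cycle.\<close>

lemma mwin_broom:
  assumes G: "finite_simple_graph G" and d: "odd d" "d \<ge> 3" and inj: "inj_on f {1..d}"
    and f0: "f 0 \<notin> {f 1, f 2, f 3}" and E: "\<And>i. i < d \<Longrightarrow> {f i, f (Suc i)} \<in> uedges G"
    and x: "{f 0, x1} \<in> uedges G" "{f 0, x2} \<in> uedges G" "x1 \<noteq> x2"
      "x1 \<notin> {f 1, f 2}" "x2 \<notin> {f 1, f 2}"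
    and y: "{f d, y1} \<in> uedges G" "{f d, y2} \<in> uedges G" "y1 \<noteq> y2"
      "y1 \<notin> {f (d - 1), f (d - 2)}" "y2 \<notin> {f (d - 1), f (d - 2)}"
      "{f d, y1} \<noteq> {f 0, f 1}" "{f d, y2} \<noteq> {f 0, f 1}"
  shows "mwin (uedges G) (P4_winning_sets G) {} {}"
proof -
  have feq: "f i = f j \<longleftrightarrow> i = j" if "1 \<le> i" "1 \<le> j" "i \<le> d" "j \<le> d" for i j
    using inj that by (auto simp: inj_on_eq_iff)
  have dist: "distinct [f 0, f 1, f 2, f 3]"
    using f0 feq[of 1 2] feq[of 1 3] feq[of 2 3] d by simp
  have x0: "x1 \<noteq> f 0" "x2 \<noteq> f 0" using edge_endpoints(3)[OF G] x by auto
  have E': "{f 0, f 1} \<in> uedges G" "{f 1, f 2} \<in> uedges G" "{f 2, f 3} \<in> uedges G"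
    using E[of 0] E[of 1] E[of 2] d by (simp_all add: numeral_2_eq_2 numeral_3_eq_3)
  show ?thesis
  proof (rule mwin_start[OF E'(2)])
    show "uedges G \<noteq> {{f 1, f 2}}" using E'(1) dist by (auto simp: doubleton_eq_iff)
    fix b assume b: "b \<in> uedges G" "b \<noteq> {f 1, f 2}"
    show "mwin (uedges G) (P4_winning_sets G) {{f 1, f 2}} {b}"
    proof (cases "b = {f 0, f 1}")
      case True
      obtain k where k: "d = k + 2" using d(2) that[of "d - 2"] by simp
      show ?thesis
      proof (rule mwin_rope[OF G, where m = k and f = "\<lambda>i. f (Suc i)" and ?y1.0 = y1 and ?y2.0 = y2])
        show "odd k" using d k by simp
        show "inj_on (\<lambda>i. f (Suc i)) {0..Suc k}" using feq k by (auto simp: inj_on_def)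
        show "{f (Suc i), f (Suc (Suc i))} \<in> uedges G" if "i \<le> k" for i using E k that by simp
        show "{f (Suc i), f (Suc (Suc i))} \<notin> {{f 1, f 2}} \<union> {b}" if "1 \<le> i" "i \<le> k" for i
          using that k feq[of 1 "Suc i"] feq[of 1 "Suc (Suc i)"] unfolding True
          by (auto simp: doubleton_eq_iff)
        show "{f (Suc (Suc k)), y1} \<notin> {{f 1, f 2}} \<union> {b}" "{f (Suc (Suc k)), y2} \<notin> {{f 1, f 2}} \<union> {b}"
          using k d y(6,7) feq[of d 1] feq[of d 2] unfolding True by (auto simp: doubleton_eq_iff)
        show "y1 \<notin> {f (Suc k), f (Suc (k - 1))}" "y2 \<notin> {f (Suc k), f (Suc (k - 1))}"
          using y(4,5) k d by (simp_all add: Suc_diff_Suc)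
      qed (use k d y(1-3) E'(2) in \<open>auto simp: numeral_2_eq_2\<close>)
    next
      case False
      \<comment> \<open>\<open>P\<close> uses the two fan edges at \<open>f 0\<close>;
        \<open>Q\<close> replaces one of them, if Breaker took it, by
        \<open>{f 2, f 3}\<close>.\<close>
      have P: "mwin (uedges G) (P4_winning_sets G) {{f 1, f 2}} {b}" if "b \<noteq> {f 0, x1}" "b \<noteq> {f 0, x2}"
        by (rule P4_reply_double_threat[OF G, of _ "{f 0, f 1}" "{f 0, x1}" "{f 0, x2}"
              _ x1 "f 0" "f 1" "f 2" x2 "f 0" "f 1" "f 2"])
          (use dist E' x x0 that False in \<open>auto simp: doubleton_eq_iff insert_commute\<close>)
      have Q: "mwin (uedges G) (P4_winning_sets G) {{f 1, f 2}} {b}"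
        if "b \<noteq> {f 0, z}" "b \<noteq> {f 2, f 3}" "{f 0, z} \<in> uedges G" "z \<notin> {f 1, f 2}" "z \<noteq> f 0" for z
        by (rule P4_reply_double_threat[OF G, of _ "{f 0, f 1}" "{f 0, z}" "{f 2, f 3}"
              _ z "f 0" "f 1" "f 2" "f 0" "f 1" "f 2" "f 3"])
          (use dist E' that False in \<open>auto simp: doubleton_eq_iff insert_commute\<close>)
      have "{f 0, x1} \<noteq> {f 0, x2}" "{f 0, x1} \<noteq> {f 2, f 3}" "{f 0, x2} \<noteq> {f 2, f 3}"
        using x(3) dist by (auto simp: doubleton_eq_iff)
      then show ?thesis using P Q[of x1] Q[of x2] x x0 by metis
    qed
  qed
qed

lemma mwin_adjacent_branch_vertices:
  assumes G: "finite_simple_graph G" and E: "{u, v} \<in> uedges G"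
    "{u, x1} \<in> uedges G" "{u, x2} \<in> uedges G" "{v, y1} \<in> uedges G" "{v, y2} \<in> uedges G"
    and d: "x1 \<noteq> x2" "y1 \<noteq> y2" "distinct [u, v, x1, y1]" "distinct [u, v, x2, y2]" "x1 \<noteq> y2" "x2 \<noteq> y1"
  shows "mwin (uedges G) (P4_winning_sets G) {} {}"
proof (rule mwin_start[OF E(1)])
  show "uedges G \<noteq> {{u, v}}" using E(2) d by (auto simp: doubleton_eq_iff)
  fix r assume "r \<in> uedges G" "r \<noteq> {u, v}"
  have P: "mwin (uedges G) (P4_winning_sets G) {{u, v}} {r}"
    if "r \<noteq> {v, y1}" "r \<noteq> {v, y2}" "r \<noteq> {u, x}" "x \<in> {x1, x2}" for x
    by (rule P4_reply_double_threat[OF G, of _ "{u, x}" "{v, y1}" "{v, y2}" _ x u v y1 x u v y2])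
      (use E d that in \<open>auto simp: doubleton_eq_iff insert_commute\<close>)
  have Q: "mwin (uedges G) (P4_winning_sets G) {{u, v}} {r}"
    if "r \<noteq> {u, x1}" "r \<noteq> {u, x2}" "r \<noteq> {v, y}" "y \<in> {y1, y2}" for y
    by (rule P4_reply_double_threat[OF G, of _ "{v, y}" "{u, x1}" "{u, x2}" _ y v u x1 y v u x2])
      (use E d that in \<open>auto simp: doubleton_eq_iff insert_commute\<close>)
  have "{u, x1} \<noteq> {u, x2}" "{v, y1} \<noteq> {v, y2}"
    "{u, x1} \<noteq> {v, y1}" "{u, x1} \<noteq> {v, y2}" "{u, x2} \<noteq> {v, y1}" "{u, x2} \<noteq> {v, y2}"
    using d by (auto simp: doubleton_eq_iff)
  then show "mwin (uedges G) (P4_winning_sets G) {{u, v}} {r}"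
    using P[of x1, simplified] P[of x2, simplified] Q[of y1, simplified] Q[of y2, simplified] by metis
qed

text \<open>The same two-by-two pattern: after the opening \<open>{b, c}\<close>, any of
  \<open>{a, b}\<close>, \<open>{a, c}\<close> together with any of \<open>{a, x}\<close>,
  \<open>{a, y}\<close> completes a path.\<close>

lemma mwin_triangle_degree_4:
  assumes G: "finite_simple_graph G" and d: "distinct [a, b, c, x, y]"
    and E: "{a, b} \<in> uedges G" "{b, c} \<in> uedges G" "{a, c} \<in> uedges G"
      "{a, x} \<in> uedges G" "{a, y} \<in> uedges G"
  shows "mwin (uedges G) (P4_winning_sets G) {} {}"
proof (rule mwin_start[OF E(2)])
  show "uedges G \<noteq> {{b, c}}" using E(1) d by (auto simp: doubleton_eq_iff)
  fix r assume "r \<in> uedges G" "r \<noteq> {b, c}"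
  have P: "mwin (uedges G) (P4_winning_sets G) {{b, c}} {r}"
    if "r \<noteq> {a, x}" "r \<noteq> {a, y}" "r \<noteq> {a, s}" "s = b \<and> t = c \<or> s = c \<and> t = b" for s t
    by (rule P4_reply_double_threat[OF G, of _ "{a, s}" "{a, x}" "{a, y}" _ x a s t y a s t])
      (use E d that in \<open>auto simp: doubleton_eq_iff insert_commute\<close>)
  have Q: "mwin (uedges G) (P4_winning_sets G) {{b, c}} {r}"
    if "r \<noteq> {a, b}" "r \<noteq> {a, c}" "r \<noteq> {a, z}" "z \<in> {x, y}" for z
    by (rule P4_reply_double_threat[OF G, of _ "{a, z}" "{a, b}" "{a, c}" _ z a b c z a c b])
      (use E d that in \<open>auto simp: doubleton_eq_iff insert_commute\<close>)
  have "{a, b} \<noteq> {a, c}" "{a, x} \<noteq> {a, y}"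
    "{a, b} \<noteq> {a, x}" "{a, b} \<noteq> {a, y}" "{a, c} \<noteq> {a, x}" "{a, c} \<noteq> {a, y}"
    using d by (auto simp: doubleton_eq_iff)
  then show "mwin (uedges G) (P4_winning_sets G) {{b, c}} {r}"
    using P[of b c] P[of c b] Q[of x, simplified] Q[of y, simplified] by metis
qed

text \<open>The opening \<open>{a, x}\<close> lies on x a b c, x a c b, y x a b and y x a c.
  Whatever the reply, two of these survive that share a second edge, and Maker claims it. This
  bounds how far a graph can extend beyond a triangle.\<close>

lemma mwin_triangle_tail:
  assumes G: "finite_simple_graph G" and d: "distinct [a, b, c, x, y]"
    and E: "{a, b} \<in> uedges G" "{b, c} \<in> uedges G" "{a, c} \<in> uedges G"
      "{a, x} \<in> uedges G" "{x, y} \<in> uedges G"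
  shows "mwin (uedges G) (P4_winning_sets G) {} {}"
proof (rule mwin_start[OF E(4)])
  show "uedges G \<noteq> {{a, x}}" using E(2) d by (auto simp: doubleton_eq_iff)
  fix r assume "r \<in> uedges G" "r \<noteq> {a, x}"
  have P: "mwin (uedges G) (P4_winning_sets G) {{a, x}} {r}"
    if "r \<noteq> {b, c}" "r \<noteq> {a, b}" "r \<noteq> {a, c}"
    by (rule P4_reply_double_threat[OF G, of _ "{b, c}" "{a, b}" "{a, c}" _ x a b c x a c b])
      (use E d that in \<open>auto simp: doubleton_eq_iff insert_commute\<close>)
  have Q: "mwin (uedges G) (P4_winning_sets G) {{a, x}} {r}" if "r = {b, c}"
    by (rule P4_reply_double_threat[OF G, of _ "{x, y}" "{a, b}" "{a, c}" _ y x a b y x a c])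
      (use E d that in \<open>auto simp: doubleton_eq_iff insert_commute\<close>)
  have R: "mwin (uedges G) (P4_winning_sets G) {{a, x}} {r}"
    if "r = {a, s}" "s = b \<and> t = c \<or> s = c \<and> t = b" for s t
    by (rule P4_reply_double_threat[OF G, of _ "{a, t}" "{b, c}" "{x, y}" _ x a t s y x a t])
      (use E d that in \<open>auto simp: doubleton_eq_iff insert_commute\<close>)
  show "mwin (uedges G) (P4_winning_sets G) {{a, x}} {r}"
    using P Q R[of b c] R[of c b] by blast
qed

text \<open>Why the three triangle vertices cannot each have an outside neighbour of their own.
  After \<open>{a, b}\<close> Maker continues with \<open>{a, c}\<close>, \<open>{a, x}\<close> or
  \<open>{b, c}\<close>; a reply that spoils the first continuation leaves one of the other two
  intact.\<close>

lemma mwin_net: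
  assumes G: "finite_simple_graph G" and d: "distinct [a, b, c, x, y, z]"
    and E: "{a, b} \<in> uedges G" "{b, c} \<in> uedges G" "{a, c} \<in> uedges G"
      "{a, x} \<in> uedges G" "{b, y} \<in> uedges G" "{c, z} \<in> uedges G"
  shows "mwin (uedges G) (P4_winning_sets G) {} {}"
proof (rule mwin_start[OF E(1)])
  show "uedges G \<noteq> {{a, b}}" using E(2) d by (auto simp: doubleton_eq_iff)
  fix r assume "r \<in> uedges G" "r \<noteq> {a, b}"
  have P: "mwin (uedges G) (P4_winning_sets G) {{a, b}} {r}"
    if "r \<noteq> {a, c}" "r \<noteq> {b, y}" "r \<noteq> {c, z}"
    by (rule P4_reply_double_threat[OF G, of _ "{a, c}" "{b, y}" "{c, z}" _ c a b y z c a b])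
      (use E d that in \<open>auto simp: doubleton_eq_iff insert_commute\<close>)
  have Q: "mwin (uedges G) (P4_winning_sets G) {{a, b}} {r}" if "r \<in> {{a, c}, {c, z}}"
    by (rule P4_reply_double_threat[OF G, of _ "{a, x}" "{b, y}" "{b, c}" _ x a b y x a b c])
      (use E d that in \<open>auto simp: doubleton_eq_iff insert_commute\<close>)
  have R: "mwin (uedges G) (P4_winning_sets G) {{a, b}} {r}" if "r = {b, y}"
    by (rule P4_reply_double_threat[OF G, of _ "{b, c}" "{a, x}" "{c, z}" _ c b a x z c b a])
      (use E d that in \<open>auto simp: doubleton_eq_iff insert_commute\<close>)
  show "mwin (uedges G) (P4_winning_sets G) {{a, b}} {r}" using P Q R by blast
qed

text \<open>The tail edge \<open>{w, z}\<close> gives Maker an extra threat, so after the opening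
  \<open>{p0, w}\<close> only its capture by Breaker calls for more than a double threat.\<close>

lemma mwin_pentagon_tail:
  assumes G: "finite_simple_graph G" and d: "distinct [p0, p1, p2, p3, p4, w, z]"
    and E: "{p0, p1} \<in> uedges G" "{p1, p2} \<in> uedges G" "{p2, p3} \<in> uedges G"
      "{p3, p4} \<in> uedges G" "{p0, p4} \<in> uedges G" "{p0, w} \<in> uedges G" "{w, z} \<in> uedges G"
  shows "mwin (uedges G) (P4_winning_sets G) {} {}"
proof (rule mwin_start[OF E(6)])
  show "uedges G \<noteq> {{p0, w}}" using E(2) d by (auto simp: doubleton_eq_iff)
  fix r assume "r \<in> uedges G" "r \<noteq> {p0, w}"
  have P: "mwin (uedges G) (P4_winning_sets G) {{p0, w}} {r}"
    if "r \<noteq> {w, z}" "r \<noteq> {p0, p1}" "r \<noteq> {p0, p4}"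
    by (rule P4_reply_double_threat[OF G, of _ "{w, z}" "{p0, p1}" "{p0, p4}" _ z w p0 p1 z w p0 p4])
      (use E d that in \<open>auto simp: doubleton_eq_iff insert_commute\<close>)
  have Q: "mwin (uedges G) (P4_winning_sets G) {{p0, w}} {r}" if "r = {p0, p1}"
    by (rule P4_reply_double_threat[OF G, of _ "{p0, p4}" "{w, z}" "{p3, p4}" _ z w p0 p4 w p0 p4 p3])
      (use E d that in \<open>auto simp: doubleton_eq_iff insert_commute\<close>)
  have R: "mwin (uedges G) (P4_winning_sets G) {{p0, w}} {r}" if "r = {p0, p4}"
    by (rule P4_reply_double_threat[OF G, of _ "{p0, p1}" "{w, z}" "{p1, p2}" _ z w p0 p1 w p0 p1 p2])
      (use E d that in \<open>auto simp: doubleton_eq_iff insert_commute\<close>)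
  \<comment> \<open>Breaker has spent his reply outside the pentagon and its leaf edge, so Maker is
    a move ahead there: one forced exchange gives her \<open>{p1, p2}\<close>, and then
    \<open>{p3, p4}\<close> threatens p1 p2 p3 p4 and w p0 p4 p3.\<close>
  have S: "mwin (uedges G) (P4_winning_sets G) {{p0, w}} {r}" if "r = {w, z}"
  proof (rule mwin_forced[where e = "{p1, p2}" and g = "{p0, p1}"])
    show "{{w, p0}, {p0, p1}, {p1, p2}} \<in> P4_winning_sets G"
      using d E by (intro P4_winning_setsI[OF G]) (auto simp: insert_commute)
    show "mwin (uedges G) (P4_winning_sets G) (insert {p1, p2} {{p0, w}}) (insert {p0, p1} {r})"
      by (rule P4_double_threat[OF G, of _ "{p3, p4}" "{p2, p3}" "{p0, p4}" _ p1 p2 p3 p4 w p0 p4 p3])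
        (use E d that in \<open>auto simp: doubleton_eq_iff insert_commute\<close>)
  qed (use E d that in \<open>auto simp: doubleton_eq_iff insert_commute\<close>)
  show "mwin (uedges G) (P4_winning_sets G) {{p0, w}} {r}" using P Q R S by metis
qed

text \<open>From \<open>{p 3, p 4}\<close> the runs to \<open>p 0\<close> have the even lengths 4
  downwards and n - 3 upwards. The replies \<open>{p 2, p 3}\<close> and \<open>{p 4, p 5}\<close>
  each block one run; Maker takes the other and ends with the edge to \<open>w\<close> and the cycle
  edge at \<open>p 0\<close> that the run does not use. Any other reply loses to a double threat
  within p 1, ..., p 6.\<close>

lemma mwin_long_odd_cycle_leaf:
  assumes G: "finite_simple_graph G" and p: "induced_cycle G n p" and n: "odd n" "n \<ge> 7"
    and w: "{p 0, w} \<in> uedges G" "w \<notin> p ` {..<n}"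
  shows "mwin (uedges G) (P4_winning_sets G) {} {}"
proof -
  have peq: "p i = p j \<longleftrightarrow> i = j" if "i < n" "j < n" for i j
    using p that by (auto simp: induced_cycle_def inj_on_def)
  have E: "{p i, p (Suc i)} \<in> uedges G" if "Suc i < n" for i
    using p that by (auto simp: induced_cycle_def nxt_def)
  have E0: "{p 0, p (n - 1)} \<in> uedges G"
    using p n by (auto simp: induced_cycle_def nxt_def)
  have wp: "w \<noteq> p i" if "i < n" for i using w(2) that by auto
  have E': "{p 0, p 1} \<in> uedges G" "{p 1, p 2} \<in> uedges G" "{p 2, p 3} \<in> uedges G"
    "{p 3, p 4} \<in> uedges G" "{p 4, p 5} \<in> uedges G" "{p 5, p 6} \<in> uedges G"
    using E[of 0] E[of 1] E[of 2] E[of 3] E[of 4] E[of 5] n by (simp_all add: numeral_eq_Suc)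
  have d: "distinct [p 0, p 1, p 2, p 3, p 4, p 5, p 6]" using peq n by simp
  have far: "w \<noteq> p 1" "w \<noteq> p 2" "w \<noteq> p (n - 1)" "w \<noteq> p (n - 2)"
    using n by (auto intro!: wp)
  have far': "p 1 \<noteq> p (n - 1)" "p 1 \<noteq> p (n - 2)" "p (n - 1) \<noteq> p 1" "p (n - 1) \<noteq> p 2"
    using n by (simp_all add: peq)
  note far = far far'
  show ?thesis
  proof (rule mwin_start[OF E'(4)])
    have "{p 0, p 1} \<noteq> {p 3, p 4}" using d by (simp add: doubleton_eq_iff)
    then show "uedges G \<noteq> {{p 3, p 4}}" using E'(1) by blast
    fix r assume "r \<in> uedges G" "r \<noteq> {p 3, p 4}"
    have P: "mwin (uedges G) (P4_winning_sets G) {{p 3, p 4}} {r}" if r: "r = {p 2, p 3}"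
    proof (rule mwin_rope[OF G, where m = "n - 4" and ?y1.0 = w and ?y2.0 = "p 1"
          and f = "\<lambda>i. if 3 + i < n then p (3 + i) else p 0"])
      \<comment> \<open>The index 3 + i reaches n only for i = n - 3, the end of the rope, where the
        run closes up at \<open>p 0\<close>.\<close>
      let ?f = "\<lambda>i. if 3 + i < n then p (3 + i) else p 0"
      show "odd (n - 4)" using n by simp
      show "inj_on ?f {0..Suc (n - 4)}"
        using peq n by (auto simp: inj_on_def split: if_splits)
      show "{?f i, ?f (Suc i)} \<in> uedges G" if "i \<le> n - 4" for i
      proof (cases "3 + Suc i < n")
        case True
        then show ?thesis using E[of "3 + i"] by simp
      next
        case False
        then have "3 + i = n - 1" using that n by simp
        then show ?thesis using E0 n by (simp add: insert_commute)
      qed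
      show "{?f i, ?f (Suc i)} \<notin> {{p 3, p 4}} \<union> {r}" if "1 \<le> i" "i \<le> n - 4" for i
        unfolding r using that n by (auto simp: doubleton_eq_iff peq)
      have "?f (Suc (n - 4)) = p 0" "?f (n - 4) = p (n - 1)" "?f (n - 4 - 1) = p (n - 2)"
        using n by auto
      note f = this
      show "{?f (Suc (n - 4)), w} \<in> uedges G" "{?f (Suc (n - 4)), p 1} \<in> uedges G"
        unfolding f by (rule w(1), rule E'(1))
      show "{?f (Suc (n - 4)), w} \<notin> {{p 3, p 4}} \<union> {r}"
        "{?f (Suc (n - 4)), p 1} \<notin> {{p 3, p 4}} \<union> {r}"
        unfolding f r using d by (auto simp: doubleton_eq_iff)
      show "w \<notin> {?f (n - 4), ?f (n - 4 - 1)}" "p 1 \<notin> {?f (n - 4), ?f (n - 4 - 1)}"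
        unfolding f using far by simp_all
      show "w \<noteq> p 1" using wp n by simp
      show "{?f 0, ?f 1} \<in> {{p 3, p 4}}" using n by simp
      show "{{p 3, p 4}} \<subseteq> uedges G" using E' by simp
    qed
    have Q: "mwin (uedges G) (P4_winning_sets G) {{p 3, p 4}} {r}" if r: "r = {p 4, p 5}"
    proof (rule mwin_rope[OF G, where m = 3 and f = "\<lambda>i. p (4 - i)"
          and ?y1.0 = w and ?y2.0 = "p (n - 1)"])
      show "inj_on (\<lambda>i. p (4 - i)) {0..Suc 3}" using peq n by (auto simp: inj_on_def)
      have i: "i = 0 \<or> i = 1 \<or> i = 2 \<or> i = 3" if "i \<le> 3" for i :: nat using that by auto
      show "{p (4 - i), p (4 - Suc i)} \<in> uedges G" if "i \<le> 3" for i
        using i[OF that] E' by (auto simp: insert_commute)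
      show "{p (4 - i), p (4 - Suc i)} \<notin> {{p 3, p 4}} \<union> {r}" if "1 \<le> i" "i \<le> 3" for i
        unfolding r using i[OF that(2)] that(1) d by (auto simp: doubleton_eq_iff)
      show "{p (4 - Suc 3), w} \<notin> {{p 3, p 4}} \<union> {r}" "{p (4 - Suc 3), p (n - 1)} \<notin> {{p 3, p 4}} \<union> {r}"
        unfolding r using d by (auto simp: doubleton_eq_iff)
      have "4 - 3 = (1::nat)" "4 - (3 - 1) = (2::nat)" by simp_all
      then show "w \<notin> {p (4 - 3), p (4 - (3 - 1))}" "p (n - 1) \<notin> {p (4 - 3), p (4 - (3 - 1))}"
        using far by simp_all
      show "w \<noteq> p (n - 1)" using wp n by simp
    qed (use w E0 E' in \<open>auto simp: insert_commute\<close>)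
    have R: "mwin (uedges G) (P4_winning_sets G) {{p 3, p 4}} {r}"
      if "r \<noteq> {p 2, p 3}" "r \<noteq> {p 4, p 5}" "r \<noteq> {p 5, p 6}"
      by (rule P4_reply_double_threat[OF G, of _ "{p 4, p 5}" "{p 2, p 3}" "{p 5, p 6}"
            _ "p 2" "p 3" "p 4" "p 5" "p 3" "p 4" "p 5" "p 6"])
        (use E' d that in \<open>auto simp: doubleton_eq_iff insert_commute\<close>)
    have S: "mwin (uedges G) (P4_winning_sets G) {{p 3, p 4}} {r}" if "r = {p 5, p 6}"
      by (rule P4_reply_double_threat[OF G, of _ "{p 2, p 3}" "{p 1, p 2}" "{p 4, p 5}"
            _ "p 1" "p 2" "p 3" "p 4" "p 2" "p 3" "p 4" "p 5"])
        (use E' d that in \<open>auto simp: doubleton_eq_iff insert_commute\<close>)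
    show "mwin (uedges G) (P4_winning_sets G) {{p 3, p 4}} {r}" using P Q R S by metis
  qed
qed

section \<open>Odd closed walks and bipartitions\<close>

text \<open>Walks of length n are the pairs in \<open>adj_rel G ^^ n\<close>, so concatenating walks
  is adding exponents.\<close>

definition adj_rel :: "'a ugraph \<Rightarrow> ('a \<times> 'a) set" where
  "adj_rel G = {(x, y). {x, y} \<in> uedges G}"

lemma relpow_adj_rel_sym:
  assumes "(x, y) \<in> adj_rel G ^^ n"
  shows "(y, x) \<in> adj_rel G ^^ n"
  using assms
proof (induction n arbitrary: y)
  case (Suc n)
  then obtain z where "(x, z) \<in> adj_rel G ^^ n" "(z, y) \<in> adj_rel G" by auto
  then have "(z, x) \<in> adj_rel G ^^ n" "(y, z) \<in> adj_rel G"
    using Suc.IH by (auto simp: adj_rel_def insert_commute)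
  then show ?case by (metis relpow_Suc_I2)
qed simp

lemma relpow_trans:
  assumes "(x, y) \<in> R ^^ m" "(y, z) \<in> R ^^ n"
  shows "(x, z) \<in> R ^^ (m + n)"
  using assms by (auto simp: relpow_add)

lemma relpow_segment:
  fixes f :: "nat \<Rightarrow> 'a"
  assumes "\<And>i. i < n \<Longrightarrow> (f i, f (Suc i)) \<in> R" "i \<le> j" "j \<le> n"
  shows "(f i, f j) \<in> R ^^ (j - i)"
  unfolding relpow_fun_conv by (rule exI[of _ "\<lambda>k. f (i + k)"]) (use assms in auto)

text \<open>A repeated vertex or a chord splits the closed walk into two closed walks whose lengths
  add up to n or n + 2. This sum is odd, so one part is odd and, by minimality, not shorter than
  n.\<close>

lemma shortest_odd_closed_walk_induced:
  fixes G :: "'a ugraph"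
  assumes G: "finite_simple_graph G" and odd: "odd n" and x: "(x, x) \<in> adj_rel G ^^ n"
    and min: "\<And>m y. odd m \<Longrightarrow> (y, y) \<in> adj_rel G ^^ m \<Longrightarrow> n \<le> m"
  shows "\<exists>p. induced_cycle G n p"
proof -
  let ?R = "adj_rel G"
  obtain f where f: "f 0 = x" "f n = x" "\<And>i. i < n \<Longrightarrow> (f i, f (Suc i)) \<in> ?R"
    using x unfolding relpow_fun_conv by blast
  have seg: "(f i, f j) \<in> ?R ^^ (j - i)" if "i \<le> j" "j \<le> n" for i j
    using relpow_segment[of n f ?R] f(3) that by blast
  have around: "(f j, f i) \<in> ?R ^^ (n - (j - i))" if "i \<le> j" "j \<le> n" for i j
    using relpow_trans[OF seg[of j n], of "f i" i] seg[of 0 i] f(1,2) that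
    by (simp add: Suc_diff_le)
  have irrefl: "(y, y) \<notin> ?R" for y using G by (auto simp: adj_rel_def finite_simple_graph_def)
  have edge: "{u, v} \<in> uedges G \<longleftrightarrow> (u, v) \<in> ?R" for u v by (simp add: adj_rel_def)
  have sym: "(v, u) \<in> ?R" if "(u, v) \<in> ?R" for u v
    using that by (simp add: adj_rel_def insert_commute)
  have "n \<noteq> 1" using x irrefl by auto
  then have n: "n \<ge> 3" using odd by presburger
  have neq: "f i \<noteq> f j" if "i < j" "j < n" for i j
  proof
    assume "f i = f j"
    then have "(f i, f i) \<in> ?R ^^ (j - i)" "(f i, f i) \<in> ?R ^^ (n - (j - i))"
      using seg[of i j] around[of i j] that by auto
    then have "odd (j - i) \<longrightarrow> n \<le> j - i" "odd (n - (j - i)) \<longrightarrow> n \<le> n - (j - i)"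
      using min by blast+
    then show False using odd that by (cases "odd (j - i)") auto
  qed
  \<comment> \<open>The odd part reaches length n only if the chord joins cyclically consecutive
    indices.\<close>
  have chord: "j = Suc i \<or> i = 0 \<and> j = n - 1" if "i < j" "j < n" "(f i, f j) \<in> ?R" for i j
  proof -
    have "(f i, f i) \<in> ?R ^^ (j - i + 1)" "(f j, f j) \<in> ?R ^^ (n - (j - i) + 1)"
      using relpow_trans[OF seg[of i j], of "f i" 1] relpow_trans[OF around[of i j], of "f j" 1]
        sym[OF that(3)] that by auto
    then have "odd (j - i + 1) \<longrightarrow> n \<le> j - i + 1" "odd (n - (j - i) + 1) \<longrightarrow> n \<le> n - (j - i) + 1"
      using min by blast+
    then show ?thesis using odd that by (cases "odd (j - i)") auto
  qed
  have succ: "(f i, f (nxt n i)) \<in> ?R" if "i < n" for i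
    using f(3)[OF that] f(1,2) by (auto simp: nxt_def)
  have "induced_cycle G n f"
    unfolding induced_cycle_def
  proof (intro conjI allI impI)
    show "inj_on f {..<n}"
      by (rule inj_onI) (metis lessThan_iff linorder_neqE_nat neq)
    show "f ` {..<n} \<subseteq> uverts G"
      using f(3) edge_endpoints(1)[OF G] by (auto simp: adj_rel_def)
    fix i j assume ij: "i < n" "j < n"
    show "{f i, f j} \<in> uedges G \<longleftrightarrow> j = nxt n i \<or> i = nxt n j"
      unfolding edge
    proof
      assume a: "(f i, f j) \<in> ?R"
      then have "i \<noteq> j" using irrefl by blast
      then show "j = nxt n i \<or> i = nxt n j"
        using chord[of i j] chord[of j i] a sym[OF a] ij
        by (cases i j rule: linorder_cases) (auto simp: nxt_def)
    next
      assume "j = nxt n i \<or> i = nxt n j"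
      then show "(f i, f j) \<in> ?R" using succ ij sym by blast
    qed
  qed (rule n)
  then show ?thesis by blast
qed

lemma connected_leaves_set:
  assumes G: "finite_simple_graph G" and "connected_ugraph G" "S \<subseteq> uverts G" "S \<noteq> {}" "S \<noteq> uverts G"
  obtains x y where "x \<in> S" "y \<in> uverts G - S" "{x, y} \<in> uedges G"
proof (rule ccontr)
  assume "\<not> thesis"
  then have closed: "{x, y} \<notin> uedges G" if "x \<in> S" "y \<in> uverts G - S" for x y
    using that \<open>\<not> thesis\<close> \<open>\<And>x y. x \<in> S \<Longrightarrow> y \<in> uverts G - S \<Longrightarrow> {x, y} \<in> uedges G \<Longrightarrow> thesis\<close> by blast
  obtain s t where st: "s \<in> S" "t \<in> uverts G - S" using assms by blast
  then have "(s, t) \<in> {(x, y). {x, y} \<in> uedges G}\<^sup>*"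
    using assms by (auto simp: connected_ugraph_def)
  then have "t \<in> S"
  proof (induction rule: rtrancl_induct)
    case (step y z)
    then have "{y, z} \<in> uedges G" by simp
    then show ?case using closed[of y z] step.IH edge_endpoints(2)[OF G] by blast
  qed (rule st(1))
  then show False using st by blast
qed

text \<open>The parts are given by the parity of walks from a root; walks of both parities to one
  vertex would combine into an odd closed walk.\<close>

lemma bipartite_if_no_odd_closed_walk:
  fixes G :: "'a ugraph"
  assumes G: "finite_simple_graph G" and conn: "connected_ugraph G"
    and no: "\<And>m y. odd m \<Longrightarrow> (y, y) \<notin> adj_rel G ^^ m"
  shows "\<exists>A B. is_bipartition G A B"
proof -
  let ?R = "adj_rel G"
  obtain r where r: "r \<in> uverts G" using conn by (auto simp: connected_ugraph_def)
  define A where "A = {v \<in> uverts G. \<exists>n. even n \<and> (r, v) \<in> ?R ^^ n}"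
  define B where "B = {v \<in> uverts G. \<exists>n. odd n \<and> (r, v) \<in> ?R ^^ n}"
  have disj: "A \<inter> B = {}"
  proof (rule ccontr)
    assume "A \<inter> B \<noteq> {}"
    then obtain v m n where "even m" "odd n" "(r, v) \<in> ?R ^^ m" "(r, v) \<in> ?R ^^ n"
      by (auto simp: A_def B_def)
    then have "(r, r) \<in> ?R ^^ (m + n)" "odd (m + n)"
      using relpow_trans relpow_adj_rel_sym by (fast, simp)
    then show False using no by blast
  qed
  have sub: "A \<subseteq> uverts G" "B \<subseteq> uverts G" by (auto simp: A_def B_def)
  have AB: "v \<in> A \<union> B" if "v \<in> uverts G" for v
  proof -
    have "(r, v) \<in> ?R\<^sup>*" using conn r that by (simp add: connected_ugraph_def adj_rel_def)
    then obtain n where "(r, v) \<in> ?R ^^ n" using rtrancl_imp_relpow by blast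
    then show ?thesis using that by (cases "even n") (auto simp: A_def B_def)
  qed
  have step: "(u \<in> A \<longrightarrow> v \<in> B) \<and> (u \<in> B \<longrightarrow> v \<in> A)" if "{u, v} \<in> uedges G" for u v
  proof -
    have walk: "(r, v) \<in> ?R ^^ Suc n" if "(r, u) \<in> ?R ^^ n" for n
      using that \<open>{u, v} \<in> uedges G\<close> by (auto simp: adj_rel_def)
    have "v \<in> uverts G" using edge_endpoints(2)[OF G that] .
    then show ?thesis
      unfolding A_def B_def using walk even_Suc by blast
  qed
  have "\<exists>a\<in>A. \<exists>b\<in>B. e = {a, b}" if e: "e \<in> uedges G" for e
  proof -
    have "card e = 2" using G e by (simp add: finite_simple_graph_def)
    then obtain u v where uv: "e = {u, v}" by (auto simp: card_2_iff)
    then have "u \<in> A \<union> B" using AB edge_endpoints(1)[OF G] e by blast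
    then show ?thesis using step e uv by (metis UnE insert_commute)
  qed
  then have "is_bipartition G A B"
    unfolding is_bipartition_def using disj sub AB by blast
  then show ?thesis by blast
qed

text \<open>\<open>z\<close> stands for the neighbour through which a path arrives; the other two
  provide the double threat.\<close>

lemma degree_3_neighbours:
  assumes G: "finite_simple_graph G" and "udegree G v \<ge> 3"
  obtains x1 x2 where "x1 \<noteq> x2" "x1 \<noteq> z" "x2 \<noteq> z" "{v, x1} \<in> uedges G" "{v, x2} \<in> uedges G"
proof -
  let ?I = "{e \<in> uedges G. v \<in> e}"
  have "finite ?I" using finite_uedges[OF G] by simp
  then have "2 \<le> card (?I - {{v, z}})"
    using assms(2) diff_card_le_card_Diff[of "{{v, z}}" ?I] by (simp add: udegree_def)
  then obtain T where "T \<subseteq> ?I - {{v, z}}" "card T = 2" by (meson obtain_subset_with_card_n)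
  then obtain e1 e2 where e: "e1 \<in> ?I - {{v, z}}" "e2 \<in> ?I - {{v, z}}" "e1 \<noteq> e2"
    by (auto simp: card_2_iff)
  obtain x1 x2 where "e1 = {v, x1}" "e2 = {v, x2}"
    using edge_obtain[OF G, of e1 v] edge_obtain[OF G, of e2 v] e by (metis Diff_iff mem_Collect_eq)
  then show ?thesis using that e by blast
qed

text \<open>A shortest path from \<open>u\<close> to \<open>v\<close> alternates between the parts,
  so its length is odd and it is the handle of a broom.\<close>

lemma mwin_bipartite:
  fixes G :: "'a ugraph"
  assumes G: "finite_simple_graph G" and conn: "connected_ugraph G" and bip: "is_bipartition G A B"
    and u: "u \<in> A" "udegree G u \<ge> 3" and v: "v \<in> B" "udegree G v \<ge> 3"
  shows "mwin (uedges G) (P4_winning_sets G) {} {}"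
proof -
  let ?R = "adj_rel G"
  have disj: "A \<inter> B = {}" and V: "A \<union> B = uverts G" using bip by (auto simp: is_bipartition_def)
  have side: "(x \<in> A \<longleftrightarrow> y \<in> B)" "(x \<in> B \<longleftrightarrow> y \<in> A)" if e: "{x, y} \<in> uedges G" for x y
  proof -
    obtain a b where "a \<in> A" "b \<in> B" "{x, y} = {a, b}"
      using bip e unfolding is_bipartition_def by metis
    then have "x = a \<and> y = b \<or> x = b \<and> y = a" by (simp add: doubleton_eq_iff)
    then show "(x \<in> A \<longleftrightarrow> y \<in> B)" "(x \<in> B \<longleftrightarrow> y \<in> A)"
      using disj \<open>a \<in> A\<close> \<open>b \<in> B\<close> by auto
  qed
  have "(u, v) \<in> ?R\<^sup>*" using conn u v V by (auto simp: connected_ugraph_def adj_rel_def)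
  then have ex: "\<exists>n. (u, v) \<in> ?R ^^ n" using rtrancl_imp_relpow by blast
  define d where "d = (LEAST n. (u, v) \<in> ?R ^^ n)"
  have "(u, v) \<in> ?R ^^ d" unfolding d_def using ex by (rule LeastI_ex)
  then obtain f where f: "f 0 = u" "f d = v" "\<And>i. i < d \<Longrightarrow> (f i, f (Suc i)) \<in> ?R"
    unfolding relpow_fun_conv by blast
  have min: "d \<le> n" if "(u, v) \<in> ?R ^^ n" for n unfolding d_def using that by (rule Least_le)
  have E: "{f i, f (Suc i)} \<in> uedges G" if "i < d" for i using f(3)[OF that] by (simp add: adj_rel_def)
  have alt: "(f i \<in> A \<longleftrightarrow> even i) \<and> (f i \<in> B \<longleftrightarrow> odd i)" if "i \<le> d" for i
    using that
  proof (induction i)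
    case 0
    then show ?case using f(1) u disj by auto
  next
    case (Suc i)
    then show ?case using side[OF E[of i]] by auto
  qed
  have neq: "f i \<noteq> f j" if "i < j" "j \<le> d" for i j
  proof
    assume "f i = f j"
    moreover have "(f 0, f i) \<in> ?R ^^ i" "(f j, f d) \<in> ?R ^^ (d - j)"
      using relpow_segment[of d f ?R 0 i] relpow_segment[of d f ?R j d] f(3) that by auto
    ultimately have "(u, v) \<in> ?R ^^ (i + (d - j))" using relpow_trans[of u "f i"] f(1,2) by simp
    then show False using min that by fastforce
  qed
  have d: "odd d" using alt[of d] f(2) v by simp
  obtain x1 x2 where x: "x1 \<noteq> x2" "x1 \<noteq> f 1" "x2 \<noteq> f 1" "{u, x1} \<in> uedges G" "{u, x2} \<in> uedges G"
    using degree_3_neighbours[OF G u(2)] by metis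
  obtain y1 y2 where y: "y1 \<noteq> y2" "y1 \<noteq> f (d - 1)" "y2 \<noteq> f (d - 1)"
    "{v, y1} \<in> uedges G" "{v, y2} \<in> uedges G"
    using degree_3_neighbours[OF G v(2)] by metis
  \<comment> \<open>Membership in the parts does the separating: \<open>x1\<close> and
    \<open>x2\<close> lie in \<open>B\<close> while \<open>f 2\<close> lies in \<open>A\<close>, and
    likewise at the other end.\<close>
  have xB: "x1 \<in> B" "x2 \<in> B" and yA: "y1 \<in> A" "y2 \<in> A"
    using side x(4,5) y(4,5) u v by blast+
  show ?thesis
  proof (cases "d = 1")
    case True
    then have "{u, v} \<in> uedges G" using E[of 0] f(1,2) by simp
    then show ?thesis
      by (rule mwin_adjacent_branch_vertices[OF G _ x(4,5) y(4,5)])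
        (use x y xB yA u v disj True f(1,2) in auto)
  next
    case False
    then have d3: "d \<ge> 3" using d by presburger
    show ?thesis
    proof (rule mwin_broom[where f = f, OF G d d3])
      show "{f i, f (Suc i)} \<in> uedges G" if "i < d" for i using E that .
      show "inj_on f {1..d}" by (rule inj_onI) (metis atLeastAtMost_iff linorder_neqE_nat neq)
      show "f 0 \<notin> {f 1, f 2, f 3}" using neq[of 0 1] neq[of 0 2] neq[of 0 3] d3 by auto
      have f2: "f 2 \<in> A" using alt[of 2] d3 by simp
      then show "x1 \<notin> {f 1, f 2}" "x2 \<notin> {f 1, f 2}" using x xB disj by auto
      have fd2: "f (d - 2) \<in> B" using alt[of "d - 2"] d3 d by simp
      then show "y1 \<notin> {f (d - 1), f (d - 2)}" "y2 \<notin> {f (d - 1), f (d - 2)}"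
        using y yA disj by auto
      have "v \<notin> {f 0, f 1}" using neq[of 0 d] neq[of 1 d] f(2) d3 by auto
      then show "{f d, y1} \<noteq> {f 0, f 1}" "{f d, y2} \<noteq> {f 0, f 1}" unfolding f(2) by blast+
    qed (use x y f in auto)
  qed
qed

lemma isomorphic_cycle_iff:
  fixes G :: "'a ugraph"
  assumes "n \<ge> 3"
  shows "isomorphic_ugraph G (cycle_ugraph n) \<longleftrightarrow> (\<exists>p. induced_cycle G n p \<and> uverts G = p ` {..<n})"
proof -
  have cyc: "{i, j} \<in> uedges (cycle_ugraph n) \<longleftrightarrow> j = nxt n i \<or> i = nxt n j" if "i < n" "j < n" for i j
  proof -
    have "Suc k mod n = nxt n k" if "k < n" for k using that by (auto simp: nxt_def)
    then have "uedges (cycle_ugraph n) = (\<lambda>k. {k, nxt n k}) ` {..<n}"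
      unfolding cycle_edges by (intro image_cong) auto
    then show ?thesis using that by (auto simp: doubleton_eq_iff image_iff)
  qed
  have V: "uverts (cycle_ugraph n) = {..<n}" by (simp add: cycle_ugraph_def)
  show ?thesis
  proof
    assume "isomorphic_ugraph G (cycle_ugraph n)"
    then obtain f where f: "bij_betw f (uverts G) {..<n}"
      and E: "\<And>u v. u \<in> uverts G \<Longrightarrow> v \<in> uverts G \<Longrightarrow>
        {u, v} \<in> uedges G \<longleftrightarrow> {f u, f v} \<in> uedges (cycle_ugraph n)"
      unfolding isomorphic_ugraph_def V by blast
    define p where "p = inv_into (uverts G) f"
    have p: "bij_betw p {..<n} (uverts G)" unfolding p_def using f by (rule bij_betw_inv_into)
    have fp: "f (p i) = i" if "i < n" for i
      using bij_betw_inv_into_right[OF f] that by (simp add: p_def)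
    have "induced_cycle G n p"
      unfolding induced_cycle_def
    proof (intro conjI allI impI)
      fix i j assume ij: "i < n" "j < n"
      then have "p i \<in> uverts G" "p j \<in> uverts G" using p by (auto simp: bij_betw_def)
      then show "{p i, p j} \<in> uedges G \<longleftrightarrow> j = nxt n i \<or> i = nxt n j"
        using E fp cyc ij by simp
    qed (use assms p in \<open>auto simp: bij_betw_def\<close>)
    then show "\<exists>p. induced_cycle G n p \<and> uverts G = p ` {..<n}"
      using p by (auto simp: bij_betw_def)
  next
    assume "\<exists>p. induced_cycle G n p \<and> uverts G = p ` {..<n}"
    then obtain p where p: "induced_cycle G n p" "uverts G = p ` {..<n}" by blast
    then have bij: "bij_betw p {..<n} (uverts G)" by (auto simp: bij_betw_def induced_cycle_def)
    let ?f = "inv_into {..<n} p"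
    have "{u, v} \<in> uedges G \<longleftrightarrow> {?f u, ?f v} \<in> uedges (cycle_ugraph n)"
      if uv: "u \<in> uverts G" "v \<in> uverts G" for u v
    proof -
      obtain i j where ij: "i < n" "j < n" "u = p i" "v = p j" using uv p(2) by auto
      then have "?f u = i" "?f v = j" using bij_betw_inv_into_left[OF bij] by auto
      then show ?thesis using cyc ij p(1) by (simp add: induced_cycle_def)
    qed
    then show "isomorphic_ugraph G (cycle_ugraph n)"
      unfolding isomorphic_ugraph_def V using bij_betw_inv_into[OF bij] by blast
  qed
qed

section \<open>Graphs with an odd cycle\<close>

definition triangle :: "'a ugraph \<Rightarrow> 'a \<Rightarrow> 'a \<Rightarrow> 'a \<Rightarrow> bool" where
  "triangle G a b c \<longleftrightarrow> distinct [a, b, c] \<and>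
     {a, b} \<in> uedges G \<and> {b, c} \<in> uedges G \<and> {a, c} \<in> uedges G"

section \<open>Triangle-free graphs with a pentagon\<close>

lemma pentagon_edges:
  assumes "induced_cycle G 5 p"
  shows "distinct [p 0, p 1, p 2, p 3, p 4]"
    "{p 0, p 1} \<in> uedges G" "{p 1, p 2} \<in> uedges G" "{p 2, p 3} \<in> uedges G"
    "{p 3, p 4} \<in> uedges G" "{p 0, p 4} \<in> uedges G"
proof -
  have inj: "inj_on p {..<5}"
    and adj: "\<And>i j. i < 5 \<Longrightarrow> j < 5 \<Longrightarrow> {p i, p j} \<in> uedges G \<longleftrightarrow> j = nxt 5 i \<or> i = nxt 5 j"
    using assms by (auto simp: induced_cycle_def)
  show "distinct [p 0, p 1, p 2, p 3, p 4]" using inj by (simp add: inj_on_eq_iff)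
  show "{p 0, p 1} \<in> uedges G" "{p 1, p 2} \<in> uedges G" "{p 2, p 3} \<in> uedges G"
    "{p 3, p 4} \<in> uedges G" "{p 0, p 4} \<in> uedges G"
    using adj[of 0 1] adj[of 1 2] adj[of 2 3] adj[of 3 4] adj[of 0 4] by (simp_all add: nxt_def)
qed

text \<open>Any two positions of an odd cycle are joined by an arc of odd length, here 5 (once
  around), 1 and 3 for k = 0, 1, 2. With an attachment at both ends, each arc is the handle of a
  broom or an edge between branch vertices.\<close>

lemma pentagon_attachment_near:
  assumes G: "finite_simple_graph G" and p: "induced_cycle G 5 p"
    and no_tri: "\<And>a b c. \<not> triangle G a b c"
    and nwin: "\<not> mwin (uedges G) (P4_winning_sets G) {} {}"
    and w: "w \<notin> p ` {..<5}" "{p 0, w} \<in> uedges G"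
    and z: "z \<notin> p ` {..<5}" "{p k, z} \<in> uedges G" and k: "k \<le> 2"
  shows "k = 0 \<and> w = z"
proof (rule ccontr)
  note d = pentagon_edges(1)[OF p] and E = pentagon_edges(2-)[OF p]
  have wz: "w \<notin> {p 0, p 1, p 2, p 3, p 4}" "z \<notin> {p 0, p 1, p 2, p 3, p 4}"
    using w(1) z(1) by auto
  assume "\<not> (k = 0 \<and> w = z)"
  then consider "k = 0" "w \<noteq> z" | "k = 1" | "k = 2" using k by linarith
  then have "mwin (uedges G) (P4_winning_sets G) {} {}"
  proof cases
    case 1
    \<comment> \<open>\<open>?f 5\<close> is \<open>p 0\<close> again: the broom runs once around
      the cycle and has the same fan \<open>w\<close>, \<open>z\<close> at both ends.\<close>
    let ?f = "\<lambda>i. if i < 5 then p i else p 0"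
    show ?thesis
    proof (rule mwin_broom[OF G, where d = 5 and f = ?f])
      have i: "i = 0 \<or> i = 1 \<or> i = 2 \<or> i = 3 \<or> i = 4" if "i < 5" for i :: nat
        using that by auto
      show "{?f i, ?f (Suc i)} \<in> uedges G" if "i < 5" for i
        using i[OF that] E by (auto simp: insert_commute numeral_eq_Suc)
      have "{1..5::nat} = {1, 2, 3, 4, 5}" by auto
      then show "inj_on ?f {1..5}" using d by (auto simp: inj_on_def)
      show "{?f 0, w} \<in> uedges G" "{?f 0, z} \<in> uedges G" "{?f 5, w} \<in> uedges G" "{?f 5, z} \<in> uedges G"
        using w z 1 by simp_all
      show "{?f 5, w} \<noteq> {?f 0, ?f 1}" "{?f 5, z} \<noteq> {?f 0, ?f 1}"
        using wz by (auto simp: doubleton_eq_iff)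
    qed (use 1 d wz in auto)
  next
    case 2
    \<comment> \<open>A common neighbour of \<open>p 0\<close> and \<open>p 1\<close> would form a
      triangle.\<close>
    have "w \<noteq> z" using no_tri[of "p 0" "p 1" w] E(1) w(2) z(2) 2 d wz by (auto simp: triangle_def)
    then show ?thesis
      using mwin_adjacent_branch_vertices[OF G E(1) w(2) E(5), of z "p 2"] z(2) E(2) d wz 2 by auto
  next
    case 3
    \<comment> \<open>The odd arc from \<open>p 2\<close> to \<open>p 0\<close> passes through
      \<open>p 3\<close> and \<open>p 4\<close>, which leaves \<open>p 1\<close> as a fan vertex at
      both ends.\<close>
    let ?f = "\<lambda>i. if i < 3 then p (2 + i) else p 0"
    show ?thesis
    proof (rule mwin_broom[OF G, where d = 3 and f = ?f])
      have i: "i = 0 \<or> i = 1 \<or> i = 2" if "i < 3" for i :: nat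
        using that by auto
      show "{?f i, ?f (Suc i)} \<in> uedges G" if "i < 3" for i
        using i[OF that] E by (auto simp: insert_commute numeral_eq_Suc)
      have "{1..3::nat} = {1, 2, 3}" by auto
      then show "inj_on ?f {1..3}" using d by (auto simp: inj_on_def)
      show "{?f 0, z} \<in> uedges G" "{?f 0, p 1} \<in> uedges G" "{?f 3, w} \<in> uedges G" "{?f 3, p 1} \<in> uedges G"
        using w z 3 E by (simp_all add: insert_commute)
      show "{?f 3, w} \<noteq> {?f 0, ?f 1}" "{?f 3, p 1} \<noteq> {?f 0, ?f 1}"
        using wz d by (auto simp: doubleton_eq_iff)
    qed (use d wz in auto)
  qed
  then show False using nwin by blast
qed

text \<open>For k = 3 and k = 4, rotating by k exchanges the roles of \<open>w\<close> and
  \<open>z\<close> and turns the offset into 5 - k, which is at most 2.\<close>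

lemma pentagon_attachment_unique:
  assumes G: "finite_simple_graph G" and p: "induced_cycle G 5 p"
    and no_tri: "\<And>a b c. \<not> triangle G a b c"
    and nwin: "\<not> mwin (uedges G) (P4_winning_sets G) {} {}"
    and w: "w \<notin> p ` {..<5}" "{p 0, w} \<in> uedges G"
    and z: "z \<notin> p ` {..<5}" "{p k, z} \<in> uedges G" and k: "k < 5"
  shows "k = 0 \<and> w = z"
proof (cases "k \<le> 2")
  case True
  then show ?thesis using pentagon_attachment_near[OF G p no_tri nwin w z] by blast
next
  case False
  obtain q where q: "induced_cycle G 5 q" "q ` {..<5} = p ` {..<5}"
    "\<And>j. j < 5 \<Longrightarrow> q j = p (if k + j < 5 then k + j else k + j - 5)"
    using induced_cycle_rotate[OF p k] by metis
  have "{q 0, z} \<in> uedges G" "{q (5 - k), w} \<in> uedges G"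
    using q(3)[of 0] q(3)[of "5 - k"] k z(2) w(2) False by auto
  then have "5 - k = 0 \<and> z = w"
    by (intro pentagon_attachment_near[OF G q(1) no_tri nwin]) (use w(1) z(1) q(2) False in auto)
  then show ?thesis using k by simp
qed

text \<open>A further vertex would be joined to \<open>w\<close>, giving a tail, or to the pentagon,
  against uniqueness of the attachment. Uniqueness also rules out a second edge from
  \<open>w\<close> to the pentagon.\<close>

lemma pentagon_case:
  fixes G :: "'a ugraph"
  assumes G: "finite_simple_graph G" and conn: "connected_ugraph G" and p: "induced_cycle G 5 p"
    and no_tri: "\<And>a b c. \<not> triangle G a b c"
    and nwin: "\<not> mwin (uedges G) (P4_winning_sets G) {} {}"
    and w: "w \<notin> p ` {..<5}" "{p 0, w} \<in> uedges G"
  shows "isomorphic_to_subgraph_of G C5_with_leaf"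
proof -
  note d = pentagon_edges(1)[OF p] and E = pentagon_edges(2-)[OF p]
  let ?C = "p ` {..<5}"
  have wV: "w \<in> uverts G" using edge_endpoints(2)[OF G w(2)] .
  have pV: "?C \<subseteq> uverts G" and inj: "inj_on p {..<5}" using p by (auto simp: induced_cycle_def)
  have uniq: "k = 0 \<and> w = z" if "z \<notin> ?C" "{p k, z} \<in> uedges G" "k < 5" for z k
    using pentagon_attachment_unique[OF G p no_tri nwin w that] .
  have V: "uverts G = insert w ?C"
  proof (rule ccontr)
    assume "uverts G \<noteq> insert w ?C"
    then obtain x y where xy: "x \<in> insert w ?C" "y \<in> uverts G - insert w ?C" "{x, y} \<in> uedges G"
      using connected_leaves_set[OF G conn, of "insert w ?C"] pV wV by auto
    show False
    proof (cases "x = w")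
      case True
      have "distinct [p 0, p 1, p 2, p 3, p 4, w, y]" using d w(1) xy(2) by auto
      then show False using mwin_pentagon_tail[OF G _ E w(2)] xy(3) True nwin by blast
    next
      case False
      then obtain k where "k < 5" "x = p k" using xy(1) by auto
      then show False using uniq[of y k] xy by auto
    qed
  qed
  let ?f = "\<lambda>v. if v = w then 5 else inv_into {..<5} p v"
  have inv: "inv_into {..<5} p (p i) = i" if "i < 5" for i using inj that by (simp add: inv_into_f_f)
  then have fp: "?f (p i) = i" if "i < 5" for i using w(1) that by auto
  have "inj_on ?f (uverts G)"
    unfolding V inj_on_insert
  proof
    show "inj_on ?f ?C" by (rule inj_onI) (use fp in auto)
    show "?f w \<notin> ?f ` (?C - {w})" using inv by auto
  qed
  moreover have "?f ` uverts G \<subseteq> uverts C5_with_leaf"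
    unfolding V C5_with_leaf_verts using inv by auto
  moreover have "?f ` e \<in> uedges C5_with_leaf" if e: "e \<in> uedges G" for e
  proof -
    have "card e = 2" using G e by (simp add: finite_simple_graph_def)
    then obtain u v where uv: "e = {u, v}" by (auto simp: card_2_iff)
    then have uvV: "u \<in> insert w ?C" "v \<in> insert w ?C" "u \<noteq> v"
      using edge_endpoints[OF G, of u v] e V by auto
    have leaf: "?f x = 0" if "{x, w} \<in> uedges G" "x \<in> ?C" for x
      using uniq[of w] w(1) that inv by auto
    have img: "?f ` e = {?f u, ?f v}" using uv by simp
    show ?thesis
    proof (cases "u = w \<or> v = w")
      case True
      then have "?f ` e = {0, 5}"
        unfolding img using leaf[of u] leaf[of v] uvV e uv by (auto simp: insert_commute)
      then show ?thesis by (simp add: C5_with_leaf_edges)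
    next
      case False
      then obtain i j where ij: "i < 5" "j < 5" "u = p i" "v = p j" using uvV by auto
      then have "j = nxt 5 i \<or> i = nxt 5 j" using p e uv by (auto simp: induced_cycle_def)
      moreover have "i = 0 \<or> i = 1 \<or> i = 2 \<or> i = 3 \<or> i = 4" "j = 0 \<or> j = 1 \<or> j = 2 \<or> j = 3 \<or> j = 4"
        using ij by auto
      ultimately have "{i, j} \<in> uedges C5_with_leaf"
        unfolding C5_with_leaf_edges nxt_def by (elim disjE) (simp_all add: insert_commute)
      then show ?thesis unfolding img ij(3,4) fp[OF ij(1)] fp[OF ij(2)] .
    qed
  qed
  ultimately show ?thesis
    unfolding isomorphic_to_subgraph_of_iff[OF G finite_simple_C5_with_leaf] by blast
qed

section \<open>Graphs with a triangle\<close>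

lemma small_graph_in_complete:
  assumes G: "finite_simple_graph G" and "card (uverts G) \<le> n"
  shows "isomorphic_to_subgraph_of G (complete_ugraph n)"
proof -
  have "finite (uverts G)" using G by (simp add: finite_simple_graph_def)
  then obtain f where f: "f ` uverts G \<subseteq> {..<n}" "inj_on f (uverts G)"
    using assms(2) card_le_inj[of "uverts G" "{..<n}"] by auto
  have "f ` e \<in> uedges (complete_ugraph n)" if e: "e \<in> uedges G" for e
  proof -
    have "card e = 2" "e \<subseteq> uverts G" using G e by (auto simp: finite_simple_graph_def)
    then obtain u v where uv: "e = {u, v}" "u \<noteq> v" by (auto simp: card_2_iff)
    then have "f u \<noteq> f v" "f u < n" "f v < n" using f \<open>e \<subseteq> uverts G\<close> by (auto simp: inj_on_eq_iff)
    then show ?thesis unfolding uv(1) by (auto simp: complete_ugraph_def)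
  qed
  then show ?thesis
    unfolding isomorphic_to_subgraph_of_iff[OF G finite_simple_complete]
    using f by (intro exI[of _ f]) (auto simp: complete_ugraph_def)
qed

lemma triangle_permute:
  assumes "triangle G a b c"
  shows "triangle G b c a" "triangle G b a c"
  using assms by (auto simp: triangle_def insert_commute)

lemma triangle_attachments_unique:
  assumes G: "finite_simple_graph G" and nwin: "\<not> mwin (uedges G) (P4_winning_sets G) {} {}"
    and t: "triangle G a b c" and w: "w \<notin> {a, b, c}" "{a, w} \<in> uedges G"
  shows "z \<notin> {a, b, c} \<Longrightarrow> {a, z} \<in> uedges G \<Longrightarrow> w = z"
    and "y \<notin> {a, b, c} \<Longrightarrow> {w, y} \<notin> uedges G"
proof -
  show "w = z" if "z \<notin> {a, b, c}" "{a, z} \<in> uedges G"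
    using mwin_triangle_degree_4[OF G, of a b c w z] nwin t w that by (auto simp: triangle_def)
  show "{w, y} \<notin> uedges G" if "y \<notin> {a, b, c}"
  proof
    assume "{w, y} \<in> uedges G"
    then have "distinct [a, b, c, w, y]"
      using edge_endpoints(3)[OF G] t w that by (auto simp: triangle_def)
    then show False
      using mwin_triangle_tail[OF G, of a b c w y] nwin t w \<open>{w, y} \<in> uedges G\<close>
      by (auto simp: triangle_def)
  qed
qed

text \<open>An edge leaving the closed neighbourhood of the triangle would start at an attached
  vertex and so form a tail.\<close>

lemma triangle_vertices:
  assumes G: "finite_simple_graph G" and conn: "connected_ugraph G"
    and nwin: "\<not> mwin (uedges G) (P4_winning_sets G) {} {}"
    and t: "triangle G a b c" and v: "v \<in> uverts G" "v \<notin> {a, b, c}"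
  shows "\<exists>u\<in>{a, b, c}. {u, v} \<in> uedges G"
proof (rule ccontr)
  assume no: "\<not> ?thesis"
  let ?S = "{a, b, c} \<union> {v. \<exists>u\<in>{a, b, c}. {u, v} \<in> uedges G}"
  have abc: "{a, b, c} \<subseteq> uverts G" using t edge_endpoints[OF G] by (auto simp: triangle_def)
  have "?S \<subseteq> uverts G" using abc edge_endpoints(2)[OF G] by blast
  moreover have "?S \<noteq> uverts G" using no v by blast
  ultimately obtain x y where xy: "x \<in> ?S" "y \<in> uverts G - ?S" "{x, y} \<in> uedges G"
    using connected_leaves_set[OF G conn, of ?S] by auto
  then have x: "x \<notin> {a, b, c}" by blast
  then obtain u where u: "u \<in> {a, b, c}" "{u, x} \<in> uedges G" using xy(1) by blast
  note t' = triangle_permute(1)[OF t] triangle_permute(1)[OF triangle_permute(1)[OF t]]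
  show False
    using triangle_attachments_unique(2)[OF G nwin t, of x y]
      triangle_attachments_unique(2)[OF G nwin t'(1), of x y]
      triangle_attachments_unique(2)[OF G nwin t'(2), of x y] u x xy by auto
qed

text \<open>What remains is to exclude outside neighbours of \<open>c\<close>: a new vertex would
  complete a net, while \<open>w\<close> or \<open>z\<close> would create a second triangle with a
  tail.\<close>

lemma triangle_case_two_attachments:
  fixes G :: "'a ugraph"
  assumes G: "finite_simple_graph G" and conn: "connected_ugraph G"
    and nwin: "\<not> mwin (uedges G) (P4_winning_sets G) {} {}"
    and t: "triangle G a b c" and w: "w \<notin> {a, b, c}" "{a, w} \<in> uedges G"
    and z: "z \<notin> {a, b, c}" "{b, z} \<in> uedges G" and "w \<noteq> z"
  shows "isomorphic_to_subgraph_of G bull_ugraph"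
proof -
  have E: "{a, b} \<in> uedges G" "{b, c} \<in> uedges G" "{a, c} \<in> uedges G" and d: "distinct [a, b, c, w, z]"
    using t w z \<open>w \<noteq> z\<close> by (auto simp: triangle_def)
  note tb = triangle_permute(1)[OF t]
  have zb: "z \<notin> {b, c, a}" using z(1) by auto
  have c: "{c, x} \<notin> uedges G" if x: "x \<notin> {a, b, c}" for x
  proof
    assume cx: "{c, x} \<in> uedges G"
    consider "x = w" | "x = z" | "x \<noteq> w" "x \<noteq> z" by blast
    then have "mwin (uedges G) (P4_winning_sets G) {} {}"
    proof cases
      case 1
      \<comment> \<open>The second triangle is a c w, its tail a b z; the case of \<open>z\<close>
        is the mirror image.\<close>
      show ?thesis
        by (rule mwin_triangle_tail[OF G, of a c w b z]) (use d E w z cx 1 in \<open>auto simp: insert_commute\<close>)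
    next
      case 2
      show ?thesis
        by (rule mwin_triangle_tail[OF G, of b c z a w]) (use d E w z cx 2 in \<open>auto simp: insert_commute\<close>)
    next
      case 3
      show ?thesis
        by (rule mwin_net[OF G, of a b c w z x]) (use d E w z cx 3 x in auto)
    qed
    then show False using nwin by blast
  qed
  have aw: "x = w" if "x \<notin> {a, b, c}" "{a, x} \<in> uedges G" for x
    using triangle_attachments_unique(1)[OF G nwin t w that] by simp
  have bz: "x = z" if "x \<notin> {a, b, c}" "{b, x} \<in> uedges G" for x
    using triangle_attachments_unique(1)[OF G nwin tb zb z(2), of x] that by auto
  have wx: "{w, x} \<notin> uedges G" if "x \<notin> {a, b, c}" for x
    using triangle_attachments_unique(2)[OF G nwin t w that] .
  have V: "uverts G \<subseteq> {a, b, c, w, z}"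
    using triangle_vertices[OF G conn nwin t] aw bz c by blast
  have nbrs: "{w, b} \<notin> uedges G" "{w, c} \<notin> uedges G" "{w, z} \<notin> uedges G" "{z, a} \<notin> uedges G" "{z, c} \<notin> uedges G"
    using aw[OF z(1)] bz[OF w(1)] c[OF w(1)] c[OF z(1)] wx[OF z(1)] \<open>w \<noteq> z\<close>
    by (auto simp: insert_commute)
  \<comment> \<open>The default 2 is the value at \<open>c\<close>; it also keeps all values inside
    the bull.\<close>
  define f where "f = (\<lambda>_. 2::nat)(a := 0, b := 1, w := 3, z := 4)"
  have f: "f a = 0" "f b = 1" "f c = 2" "f w = 3" "f z = 4" using d by (auto simp: f_def)
  then have "inj_on f {a, b, c, w, z}" using d by (simp add: inj_on_def)
  then have "inj_on f (uverts G)" using V by (rule inj_on_subset)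
  moreover have "f ` uverts G \<subseteq> uverts bull_ugraph" by (auto simp: bull_verts f_def)
  moreover have "f ` e \<in> uedges bull_ugraph" if e: "e \<in> uedges G" for e
  proof -
    have "card e = 2" using G e by (simp add: finite_simple_graph_def)
    then obtain u v where uv: "e = {u, v}" "u \<noteq> v" by (auto simp: card_2_iff)
    then have e': "{u, v} \<in> uedges G" and "u \<in> {a, b, c, w, z}" "v \<in> {a, b, c, w, z}"
      using edge_endpoints[OF G, of u v] e V by auto
    from this(2,3) have "{u, v} \<in> {{a, b}, {b, c}, {a, c}, {a, w}, {b, z}}"
      by (elim insertE emptyE) (use e' uv(2) nbrs in \<open>simp_all add: insert_commute\<close>)
    then show ?thesis
      unfolding uv(1) bull_edges by (elim insertE emptyE) (simp_all add: f)
  qed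
  ultimately show ?thesis
    unfolding isomorphic_to_subgraph_of_iff[OF G finite_simple_bull] by blast
qed

text \<open>Four vertices always fit into \<open>complete_ugraph 4\<close>. With five, two vertices
  lie off the triangle, and they are attached at different corners because each corner has at most
  one outside neighbour.\<close>

lemma triangle_case:
  fixes G :: "'a ugraph"
  assumes G: "finite_simple_graph G" and conn: "connected_ugraph G"
    and nwin: "\<not> mwin (uedges G) (P4_winning_sets G) {} {}"
    and t: "triangle G a b c"
  shows "isomorphic_to_subgraph_of G bull_ugraph \<or> isomorphic_to_subgraph_of G (complete_ugraph 4)"
proof (cases "\<exists>w. uverts G \<subseteq> {a, b, c, w}")
  case True
  then obtain w where "uverts G \<subseteq> {a, b, c, w}" by blast
  then have "card (uverts G) \<le> card {a, b, c, w}" by (intro card_mono) auto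
  also have "\<dots> \<le> 4" by (simp add: card_insert_if)
  finally show ?thesis using small_graph_in_complete[OF G] by blast
next
  case False
  then obtain w where w: "w \<in> uverts G" "w \<notin> {a, b, c}" by blast
  obtain z where z: "z \<in> uverts G" "z \<notin> {a, b, c}" "z \<noteq> w" using False by blast
  obtain u v where uv: "u \<in> {a, b, c}" "v \<in> {a, b, c}" "{u, w} \<in> uedges G" "{v, z} \<in> uedges G"
    using triangle_vertices[OF G conn nwin t] w z by metis
  \<comment> \<open>Any two corners can be moved to the first and last place of the triangle, which
    replaces a case distinction on \<open>u\<close> and \<open>v\<close>.\<close>
  have tri: "\<exists>y. triangle G u y x \<and> {u, y, x} = {a, b, c}" if "u \<in> {a, b, c}" "x \<in> {a, b, c}" "u \<noteq> x" for u x
    using that triangle_permute[OF t] triangle_permute[OF triangle_permute(1)[OF t]]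
      triangle_permute[OF triangle_permute(2)[OF t]] t by (elim insertE emptyE; auto)
  have "u \<noteq> v"
  proof
    assume "u = v"
    obtain x where "x \<in> {a, b, c}" "u \<noteq> x" using t uv(1) by (auto simp: triangle_def)
    then obtain y where y: "triangle G u y x" "{u, y, x} = {a, b, c}" using tri[OF uv(1)] by blast
    then show False
      using triangle_attachments_unique(1)[OF G nwin y(1), of w z] w z uv \<open>u = v\<close> by auto
  qed
  then obtain y where y: "triangle G u y v" "{u, y, v} = {a, b, c}" using tri[OF uv(1,2)] by blast
  have t': "triangle G u v y" using y(1) by (auto simp: triangle_def insert_commute)
  have "w \<notin> {u, v, y}" "z \<notin> {u, v, y}" using w z y(2) by auto
  then show ?thesis
    using triangle_case_two_attachments[OF G conn nwin t' _ uv(3) _ uv(4)] z(3) by auto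
qed

text \<open>Minimality of the odd closed walk is used twice: it makes the cycle induced, and for
  length 5 it excludes triangles.\<close>

lemma odd_cycle_case:
  fixes G :: "'a ugraph"
  assumes G: "finite_simple_graph G" and conn: "connected_ugraph G"
    and nwin: "\<not> mwin (uedges G) (P4_winning_sets G) {} {}"
    and walk: "odd m" "(y, y) \<in> adj_rel G ^^ m"
  shows "(\<exists>n. odd n \<and> n \<ge> 3 \<and> isomorphic_ugraph G (cycle_ugraph n)) \<or>
    isomorphic_to_subgraph_of G bull_ugraph \<or>
    isomorphic_to_subgraph_of G (complete_ugraph 4) \<or>
    isomorphic_to_subgraph_of G C5_with_leaf"
proof -
  let ?P = "\<lambda>n. odd n \<and> (\<exists>y. (y, y) \<in> adj_rel G ^^ n)"
  define n where "n = (LEAST n. ?P n)"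
  have "?P n" unfolding n_def by (rule LeastI[of ?P m]) (use walk in blast)
  then obtain x where n: "odd n" "(x, x) \<in> adj_rel G ^^ n" by blast
  have min: "n \<le> k" if "odd k" "(z, z) \<in> adj_rel G ^^ k" for k z
    unfolding n_def by (rule Least_le) (use that in blast)
  obtain p where p: "induced_cycle G n p"
    using shortest_odd_closed_walk_induced[OF G n] min by blast
  then have n3: "n \<ge> 3" and pV: "p ` {..<n} \<subseteq> uverts G" by (auto simp: induced_cycle_def)
  show ?thesis
  proof (cases "p ` {..<n} = uverts G")
    case True
    then show ?thesis using isomorphic_cycle_iff[OF n3, of G] p n(1) n3 by metis
  next
    case False
    have "p 0 \<in> p ` {..<n}" using n3 by simp
    then have "p ` {..<n} \<noteq> {}" by blast
    then obtain v w where vw: "v \<in> p ` {..<n}" "w \<in> uverts G - p ` {..<n}" "{v, w} \<in> uedges G"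
      using connected_leaves_set[OF G conn pV _ False] by metis
    then obtain i where i: "i < n" "v = p i" by blast
    obtain q where q: "induced_cycle G n q" "q ` {..<n} = p ` {..<n}"
      "\<And>j. j < n \<Longrightarrow> q j = p (if i + j < n then i + j else i + j - n)"
      using induced_cycle_rotate[OF p i(1)] by metis
    have w: "w \<notin> q ` {..<n}" "{q 0, w} \<in> uedges G"
      using vw i q(2) q(3)[of 0] n3 by auto
    have "n < 7"
      using mwin_long_odd_cycle_leaf[OF G q(1) n(1) _ w(2,1)] nwin by (meson not_le)
    then have "n = 3 \<or> n = 5" using n(1) n3 by presburger
    then consider "n = 3" | "n = 5" by blast
    then show ?thesis
    proof cases
      case 1
      have "{q 0, q 1} \<in> uedges G" "{q 1, q 2} \<in> uedges G" "{q 0, q 2} \<in> uedges G" "distinct [q 0, q 1, q 2]"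
        using q(1) 1 by (auto simp: induced_cycle_def nxt_def inj_on_eq_iff)
      then have "triangle G (q 0) (q 1) (q 2)" by (simp add: triangle_def)
      then show ?thesis using triangle_case[OF G conn nwin] by blast
    next
      case 2
      have "\<not> triangle G a b c" for a b c
      proof
        assume "triangle G a b c"
        then have "(a, a) \<in> adj_rel G ^^ 3"
          by (auto simp: triangle_def adj_rel_def numeral_3_eq_3 insert_commute)
        then show False using min[of 3 a] 2 by simp
      qed
      then show ?thesis
        using pentagon_case[OF G conn _ _ nwin, of q w] q(1) w 2 by blast
    qed
  qed
qed

theorem theorem9:
  fixes G :: "'a ugraph"
  assumes "finite_simple_graph G" and "connected_ugraph G"
  shows "breaker_wins_P4_game G \<longleftrightarrow>
    (\<exists>A B. is_bipartition G A B \<and>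
       ({v \<in> uverts G. udegree G v \<ge> 3} \<subseteq> A \<or> {v \<in> uverts G. udegree G v \<ge> 3} \<subseteq> B)) \<or>
    (\<exists>n. odd n \<and> n \<ge> 3 \<and> isomorphic_ugraph G (cycle_ugraph n)) \<or>
    (isomorphic_to_subgraph_of G bull_ugraph \<or>
     isomorphic_to_subgraph_of G (complete_ugraph 4) \<or>
     isomorphic_to_subgraph_of G C5_with_leaf)"
    (is "_ \<longleftrightarrow> ?bip \<or> ?cycle \<or> ?small")
proof -
  note G = assms(1) and conn = assms(2)
  let ?W = "mwin (uedges G) (P4_winning_sets G) {} {}"
  have "\<not> ?W" if bip: ?bip
  proof -
    obtain A B where AB: "is_bipartition G A B"
      "{v \<in> uverts G. udegree G v \<ge> 3} \<subseteq> A \<or> {v \<in> uverts G. udegree G v \<ge> 3} \<subseteq> B"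
      using bip by blast
    have BA: "is_bipartition G B A" using AB(1) unfolding is_bipartition_def by (metis Un_commute Int_commute insert_commute)
    have disj: "A \<inter> B = {}" "A \<union> B = uverts G" using AB(1) by (auto simp: is_bipartition_def)
    from AB(2) show ?thesis
    proof
      assume "{v \<in> uverts G. udegree G v \<ge> 3} \<subseteq> A"
      then show ?thesis using disj by (intro not_mwin_bipartite[OF G AB(1)]) fastforce
    next
      assume "{v \<in> uverts G. udegree G v \<ge> 3} \<subseteq> B"
      then show ?thesis using disj by (intro not_mwin_bipartite[OF G BA]) fastforce
    qed
  qed
  moreover have "\<not> ?W" if ?cycle
    using that isomorphic_cycle_iff[of _ G] not_mwin_odd_cycle[OF G] by metis
  moreover have "\<not> ?W" if ?small
    using that not_mwin_subgraph[OF G finite_simple_bull _ not_mwin_bull]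
      not_mwin_subgraph[OF G finite_simple_complete _ not_mwin_K4]
      not_mwin_subgraph[OF G finite_simple_C5_with_leaf _ not_mwin_C5_with_leaf] by blast
  moreover have "?bip \<or> ?cycle \<or> ?small" if nwin: "\<not> ?W"
  proof (cases "\<exists>m y. odd m \<and> (y, y) \<in> adj_rel G ^^ m")
    case True
    then show ?thesis using odd_cycle_case[OF G conn nwin] by blast
  next
    case False
    then obtain A B where AB: "is_bipartition G A B"
      using bipartite_if_no_odd_closed_walk[OF G conn] by blast
    then have "A \<union> B = uverts G" by (simp add: is_bipartition_def)
    \<comment> \<open>If both parts held a vertex of degree at least 3, Maker would win; hence one
      part contains them all.\<close>
    then have ?bip using mwin_bipartite[OF G conn AB] nwin AB by blast
    then show ?thesis by blast
  qed
  ultimately show ?thesis unfolding breaker_wins_P4_game_iff[OF G] by blast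
qed

end
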